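(* The monodromy group of the rational curves in the linear system $|\mathcal{O}(1)|$ on a generic K3 surface of genus $1$ over $\mathbb{C}$ is the full symmetric group $S_{24}$. That is, the monodromy group of the degree $24$ map $\pi\colon Z\to V$ defined in the context is the full symmetric group $S_{24}$.
   Context: Monodromy group: let $X,Y$ be irreducible algebraic varieties of the same dimension over $\mathbb{C}$ and $\pi\colon Y\to X$ a map of degree $d>0$. For a suitably small nonempty Zariski open $U\subset X$, $\pi^{-1}(U)\to U$ is an unbranched covering of degree $d$. For a generic $p\in U$, lifting loops in $U$ based at $p$ gives a homomorphism $\pi_1(U,p)\to S_d$, the group of permutations of $\pi^{-1}(p)$. Its image, which is independent of the choice of $U$, is called the monodromy group of $\pi$. K3 surfaces of genus $1$ here are elliptic K3 surfaces over $\mathbb{P}^1$ with a section. They are given by Weierstrass equations $y^2z=x^3+Axz^2+Bz^3$ with $(A,B)\in V:=H^0(\mathbb{P}^1,\mathcal{O}_{\mathbb{P}^1}(8))\times H^0(\mathbb{P}^1,\mathcal{O}_{\mathbb{P}^1}(12))$. For generic $(A,B)\in V$ the discriminant $\Delta=4A^3+27B^2\in H^0(\mathbb{P}^1,\mathcal{O}_{\mathbb{P}^1}(24))$ vanishes at $24$ distinct points, and the fibers over these points are the $24$ nodal rational curves in $|\mathcal{O}(1)|$ (the class of a fiber). The monodromy group of the rational curves is by definition the monodromy group of the projection $\pi\colon Z\to V$, where $$Z=\{(A,B,t)\in V\times\mathbb{P}^1 \mid 4A^3(t)+27B^2(t)=0\}.$$ *)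

theory Defs
  imports "HOL-Analysis.Analysis" "HOL-Combinatorics.Permutations"
begin

section \<open>The complex projective line\<close>

definition same_line :: "complex \<times> complex \<Rightarrow> complex \<times> complex \<Rightarrow> bool" where
  "same_line v w \<longleftrightarrow> v \<noteq> 0 \<and> (\<exists>c. c \<noteq> 0 \<and> w = (c * fst v, c * snd v))"

lemma part_equivp_same_line: "part_equivp same_line"
proof (rule part_equivpI)
  show "\<exists>x. same_line x x"
    by (intro exI[of _ "(1, 0)"]) (auto simp: same_line_def zero_prod_def intro!: exI[of _ 1])
  show "symp same_line"
  proof (rule sympI)
    fix v w assume "same_line v w"
    then obtain c where "v \<noteq> 0" "c \<noteq> 0" and w: "w = (c * fst v, c * snd v)"
      by (auto simp: same_line_def)
    then show "same_line w v"
      by (auto simp: same_line_def zero_prod_def prod_eq_iff intro!: exI[of _ "inverse c"])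
  qed
  show "transp same_line"
  proof (rule transpI)
    fix u v w assume "same_line u v" "same_line v w"
    then obtain c d where "u \<noteq> 0" "c \<noteq> 0" "d \<noteq> 0"
      "v = (c * fst u, c * snd u)" "w = (d * fst v, d * snd v)"
      by (auto simp: same_line_def)
    then show "same_line u w"
      by (auto simp: same_line_def intro!: exI[of _ "d * c"])
  qed
qed

quotient_type cp1 = "complex \<times> complex" / partial: same_line
  by (rule part_equivp_same_line)

text \<open>The classical topology, i.e. the quotient topology of the nonzero vectors.\<close>

instantiation cp1 :: topological_space
begin

definition open_cp1 :: "cp1 set \<Rightarrow> bool" where
  "open_cp1 W \<longleftrightarrow> open {v. v \<noteq> 0 \<and> abs_cp1 v \<in> W}"

instance
proof
  have "{v :: complex \<times> complex. v \<noteq> 0 \<and> abs_cp1 v \<in> UNIV} = - {0}"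
    by auto
  then show "open (UNIV :: cp1 set)"
    unfolding open_cp1_def by (metis closed_singleton open_Compl)
next
  fix S T :: "cp1 set" assume "open S" "open T"
  moreover have "{v. v \<noteq> 0 \<and> abs_cp1 v \<in> S \<inter> T}
      = {v. v \<noteq> 0 \<and> abs_cp1 v \<in> S} \<inter> {v. v \<noteq> 0 \<and> abs_cp1 v \<in> T}"
    by auto
  ultimately show "open (S \<inter> T)"
    unfolding open_cp1_def by (simp only: open_Int)
next
  fix K :: "cp1 set set" assume "\<forall>S\<in>K. open S"
  moreover have "{v. v \<noteq> 0 \<and> abs_cp1 v \<in> \<Union>K} = (\<Union>S\<in>K. {v. v \<noteq> 0 \<and> abs_cp1 v \<in> S})"
    by auto
  ultimately show "open (\<Union>K)"
    unfolding open_cp1_def by (simp only: open_UN)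
qed

end


section \<open>Weierstrass data and the incidence variety\<close>

text \<open>
  A global section of the line bundle of degree \<open>n\<close> on the projective line is a binary form of
  degree \<open>n\<close>, given here by its \<open>n + 1\<close> coefficients. Since \<open>of_nat\<close> is a bijection from
  \<open>{..8}\<close> onto the type \<open>9\<close> (and from \<open>{..12}\<close> onto \<open>13\<close>), \<open>A $ of_nat i\<close> runs through all
  coefficients of \<open>A\<close>.
\<close>

definition binary_form :: "nat \<Rightarrow> (nat \<Rightarrow> complex) \<Rightarrow> complex \<times> complex \<Rightarrow> complex" where
  "binary_form n c v = (\<Sum>i\<le>n. c i * fst v ^ i * snd v ^ (n - i))"

type_synonym weierstrass = "(complex ^ 9) \<times> (complex ^ 13)"

definition discriminant :: "weierstrass \<Rightarrow> complex \<times> complex \<Rightarrow> complex" where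
  "discriminant = (\<lambda>(A, B) v.
     4 * binary_form 8 (\<lambda>i. A $ of_nat i) v ^ 3 + 27 * binary_form 12 (\<lambda>i. B $ of_nat i) v ^ 2)"

lemma binary_form_scale:
  "binary_form n a (c * fst v, c * snd v) = c ^ n * binary_form n a v"
proof -
  have "a i * (c * fst v) ^ i * (c * snd v) ^ (n - i)
      = c ^ n * (a i * fst v ^ i * snd v ^ (n - i))" if "i \<le> n" for i
  proof -
    have "c ^ n = c ^ i * c ^ (n - i)"
      using that by (simp flip: power_add)
    then show ?thesis
      by (simp add: power_mult_distrib)
  qed
  then show ?thesis
    unfolding binary_form_def sum_distrib_left by (intro sum.cong) simp_all
qed

lemma discriminant_scale:
  "discriminant E (c * fst v, c * snd v) = c ^ 24 * discriminant E v"
proof -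
  have "4 * (c ^ 8 * a) ^ 3 + 27 * (c ^ 12 * b) ^ 2 = c ^ 24 * (4 * a ^ 3 + 27 * b ^ 2)" for a b
    by algebra
  then show ?thesis
    by (simp only: discriminant_def binary_form_scale split: prod.split) blast
qed

lift_definition discriminant_vanishes :: "weierstrass \<Rightarrow> cp1 \<Rightarrow> bool"
  is "\<lambda>E v. discriminant E v = 0"
  by (auto simp only: same_line_def discriminant_scale mult_eq_0_iff power_eq_0_iff)

definition Z :: "(weierstrass \<times> cp1) set" where
  "Z = {(E, q). discriminant_vanishes E q}"


section \<open>Zariski open subsets of the parameter space\<close>

inductive_set polynomial_functions :: "(weierstrass \<Rightarrow> complex) set" where
  const: "(\<lambda>_. c) \<in> polynomial_functions"
| coord_A: "(\<lambda>E. fst E $ i) \<in> polynomial_functions"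
| coord_B: "(\<lambda>E. snd E $ j) \<in> polynomial_functions"
| add: "f \<in> polynomial_functions \<Longrightarrow> g \<in> polynomial_functions
    \<Longrightarrow> (\<lambda>E. f E + g E) \<in> polynomial_functions"
| mult: "f \<in> polynomial_functions \<Longrightarrow> g \<in> polynomial_functions
    \<Longrightarrow> (\<lambda>E. f E * g E) \<in> polynomial_functions"

definition zariski_open :: "weierstrass set \<Rightarrow> bool" where
  "zariski_open U \<longleftrightarrow> (\<exists>F \<subseteq> polynomial_functions. U = - {E. \<forall>f\<in>F. f E = 0})"


section \<open>Monodromy\<close>

definition fibre :: "'y set \<Rightarrow> ('y \<Rightarrow> 'x) \<Rightarrow> 'x \<Rightarrow> 'y set" where
  "fibre Y \<pi> p = {y \<in> Y. \<pi> y = p}"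

definition unbranched_over ::
    "nat \<Rightarrow> 'y::topological_space set \<Rightarrow> ('y \<Rightarrow> 'x::topological_space) \<Rightarrow> 'x set \<Rightarrow> bool" where
  "unbranched_over d Y \<pi> U \<longleftrightarrow>
     covering_space (Y \<inter> \<pi> -` U) \<pi> U \<and>
     (\<forall>p\<in>U. finite (fibre Y \<pi> p) \<and> card (fibre Y \<pi> p) = d)"

text \<open>
  The image of the fundamental group of \<open>U\<close> at \<open>p\<close> in the permutations of the fibre: the
  permutations \<open>\<sigma>\<close> induced by some loop \<open>\<gamma>\<close>, whose lift starting at \<open>y\<close> ends at \<open>\<sigma> y\<close>. Only
  meaningful when the map is a covering over \<open>U\<close>, where lifts exist and are unique.
\<close>

definition monodromy_group ::
    "'y::topological_space set \<Rightarrow> ('y \<Rightarrow> 'x::topological_space) \<Rightarrow> 'x set \<Rightarrow> 'x \<Rightarrow> ('y \<Rightarrow> 'y) set"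
  where
  "monodromy_group Y \<pi> U p =
     {\<sigma>. \<sigma> permutes fibre Y \<pi> p \<and>
        (\<exists>\<gamma>. path \<gamma> \<and> path_image \<gamma> \<subseteq> U \<and> pathstart \<gamma> = p \<and> pathfinish \<gamma> = p \<and>
          (\<forall>y \<in> fibre Y \<pi> p. \<exists>\<eta>. path \<eta> \<and> path_image \<eta> \<subseteq> Y \<and> (\<forall>t\<in>{0..1}. \<pi> (\<eta> t) = \<gamma> t) \<and>
             pathstart \<eta> = y \<and> pathfinish \<eta> = \<sigma> y))}"

end

theory Submission
  imports Defs
    "HOL-Computational_Algebra.Computational_Algebra"
    "HOL-Computational_Algebra.Field_as_Ring"
    "Subresultants.Subresultant_Gcd"
begin

text \<open>
  Every transposition of two zeros \<open>y\<close>, \<open>y'\<close> of the discriminant is realized by a loop, and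
  transpositions generate the symmetric group.

  The loops come from an explicit family (\<open>family\<close>) of Weierstrass data with two marked zeros of
  the discriminant. A pair \<open>(A, B)\<close> has a zero of the discriminant at a point exactly if its values
  there are \<open>-3 c^2\<close> and \<open>2 c^3\<close> for some \<open>c\<close>. Hence the pairs with zeros at two points are those
  of the form \<open>A = -3 C^2 + l m P\<close>, \<open>B = 2 C^3 + l m Q\<close>, where \<open>l\<close> and \<open>m\<close> are linear forms that
  vanish at the points (\<open>family_surj\<close>). The two points and the coefficients of \<open>C\<close>, \<open>P\<close>, \<open>Q\<close> form
  an affine space. Three properties of this parametrization give the result.

  \<^item> The part of the parameter space that lies over a Zariski open set \<open>U\<close> and has different marked
    points meets every complex line that it meets at all in the complement of a finite set. Its
    intersection with any convex open set is therefore path connected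
    (\<open>path_connected_convex_Int_cofinite\<close>). In particular any pair of zeros can be moved to any other
    pair of zeros, with the Weierstrass data in \<open>U\<close> all the time.

  \<^item> Exchanging the two points is a symmetry of the parametrization that fixes the Weierstrass data.
    Parameters on the diagonal, where the points coincide, are fixed by it, and there the discriminant
    has a zero that is at least double.

  \<^item> There is a parameter \<open>x0\<close> on the diagonal with 22 further distinct zeros
    (\<open>family_with_double_zero\<close>). A path in a small ball around \<open>x0\<close> from \<open>x\<close> to its mirror image
    maps to a loop that exchanges the marked zeros and returns the other 22 to their places
    (\<open>local_swap\<close>).

  Moving \<open>y\<close>, \<open>y'\<close> to such a position, swapping them there and moving back is the required loop
  (\<open>transposition_in_monodromy_group\<close>).

  An open set over which the 24 zeros form an unbranched covering is given by the nonvanishing of a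
  resultant (\<open>unbranched_over_simple_locus\<close>).
\<close>

(* smult and $ denote scalar multiples of polynomials and components of vectors throughout. *)
hide_const (open) Module.smult
no_notation Matrix.vec_index (infixl "$" 100)

section \<open>Path lifting and monodromy groups\<close>

definition lift_joins :: "'y::topological_space set \<Rightarrow> ('y \<Rightarrow> 'x) \<Rightarrow> (real \<Rightarrow> 'x) \<Rightarrow> 'y \<Rightarrow> 'y \<Rightarrow> bool" where
  "lift_joins Y \<pi> \<gamma> y z \<longleftrightarrow> (\<exists>\<eta>. path \<eta> \<and> path_image \<eta> \<subseteq> Y \<and> (\<forall>t\<in>{0..1}. \<pi> (\<eta> t) = \<gamma> t) \<and>
     pathstart \<eta> = y \<and> pathfinish \<eta> = z)"

lemma lift_joins_mono: "lift_joins C \<pi> \<gamma> y z \<Longrightarrow> C \<subseteq> Y \<Longrightarrow> lift_joins Y \<pi> \<gamma> y z"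
  unfolding lift_joins_def by blast

lemma lift_joins_reversepath:
  assumes "lift_joins Y \<pi> \<gamma> y z"
  shows "lift_joins Y \<pi> (reversepath \<gamma>) z y"
proof -
  obtain \<eta> where \<eta>: "path \<eta>" "path_image \<eta> \<subseteq> Y" "\<forall>t\<in>{0..1}. \<pi> (\<eta> t) = \<gamma> t"
    "pathstart \<eta> = y" "pathfinish \<eta> = z"
    using assms unfolding lift_joins_def by blast
  then have "\<pi> (reversepath \<eta> t) = reversepath \<gamma> t" if "t \<in> {0..1}" for t
    using that by (simp add: reversepath_def)
  then have "\<forall>t\<in>{0..1}. \<pi> (reversepath \<eta> t) = reversepath \<gamma> t"
    by blast
  moreover have "path (reversepath \<eta>)" "path_image (reversepath \<eta>) \<subseteq> Y"
    "pathstart (reversepath \<eta>) = z" "pathfinish (reversepath \<eta>) = y"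
    using \<eta> by simp_all
  ultimately show ?thesis
    unfolding lift_joins_def by blast
qed

lemma lift_joins_joinpaths:
  assumes "lift_joins Y \<pi> \<gamma> y z" "lift_joins Y \<pi> \<delta> z w"
  shows "lift_joins Y \<pi> (\<gamma> +++ \<delta>) y w"
proof -
  obtain \<eta> where \<eta>: "path \<eta>" "path_image \<eta> \<subseteq> Y" "\<forall>t\<in>{0..1}. \<pi> (\<eta> t) = \<gamma> t"
    "pathstart \<eta> = y" "pathfinish \<eta> = z"
    using assms(1) unfolding lift_joins_def by blast
  obtain \<theta> where \<theta>: "path \<theta>" "path_image \<theta> \<subseteq> Y" "\<forall>t\<in>{0..1}. \<pi> (\<theta> t) = \<delta> t"
    "pathstart \<theta> = z" "pathfinish \<theta> = w"
    using assms(2) unfolding lift_joins_def by blast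
  show ?thesis
    unfolding lift_joins_def
  proof (intro exI[of _ "\<eta> +++ \<theta>"] conjI)
    show "path (\<eta> +++ \<theta>)" "pathstart (\<eta> +++ \<theta>) = y" "pathfinish (\<eta> +++ \<theta>) = w"
      using \<eta> \<theta> by auto
    show "path_image (\<eta> +++ \<theta>) \<subseteq> Y"
      using \<eta> \<theta> by (simp add: path_image_join)
    show "\<forall>t\<in>{0..1}. \<pi> ((\<eta> +++ \<theta>) t) = (\<gamma> +++ \<delta>) t"
      using \<eta>(3) \<theta>(3) by (auto simp: joinpaths_def)
  qed
qed

text \<open>
  The lifts of a path starting at the points of the first fibre end in distinct points that exhaust
  the last fibre. Over an interval that \<open>\<gamma>\<close> maps into one evenly covered set, each sheet carries
  exactly one lift; such intervals are glued with Bolzano's principle. The finitely many given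
  sections \<open>S\<close> are carried along because locally each of them stays in one sheet, which spares an
  argument about uniqueness of lifts.
\<close>

lemma covering_space_path_transport:
  fixes \<pi> :: "'y::topological_space \<Rightarrow> 'x::topological_space"
  assumes cov: "covering_space C \<pi> U"
    and \<gamma>: "path \<gamma>" "path_image \<gamma> \<subseteq> U"
    and fin: "finite S"
    and S: "\<And>s. s \<in> S \<Longrightarrow> continuous_on {0..1} s \<and> (\<forall>t\<in>{0..1}. s t \<in> C \<and> \<pi> (s t) = \<gamma> t)"
  obtains \<sigma> where "bij_betw \<sigma> (fibre C \<pi> (pathstart \<gamma>)) (fibre C \<pi> (pathfinish \<gamma>))"
    and "\<And>y. y \<in> fibre C \<pi> (pathstart \<gamma>) \<Longrightarrow> lift_joins C \<pi> \<gamma> y (\<sigma> y)"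
    and "\<And>s. s \<in> S \<Longrightarrow> \<sigma> (s 0) = s 1"
proof -
  (* The claim for the restriction of \<open>\<gamma>\<close> to the interval from a to b, in a form that can be glued. *)
  define P where "P a b \<longleftrightarrow> (0 \<le> a \<and> a \<le> b \<and> b \<le> 1 \<longrightarrow>
    (\<exists>\<sigma>. bij_betw \<sigma> (fibre C \<pi> (\<gamma> a)) (fibre C \<pi> (\<gamma> b)) \<and>
       (\<forall>y \<in> fibre C \<pi> (\<gamma> a). \<exists>\<eta>. continuous_on {a..b} \<eta> \<and>
          (\<forall>t\<in>{a..b}. \<eta> t \<in> C \<and> \<pi> (\<eta> t) = \<gamma> t) \<and> \<eta> a = y \<and> \<eta> b = \<sigma> y) \<and>
       (\<forall>s\<in>S. \<sigma> (s a) = s b)))" for a b :: real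
  have cont\<gamma>: "continuous_on {0..1} \<gamma>" and \<gamma>U: "\<And>t. t \<in> {0..1} \<Longrightarrow> \<gamma> t \<in> U"
    using \<gamma> by (auto simp: path_def path_image_def)
  have "P 0 1"
  proof (rule Bolzano)
    fix a b c :: real
    assume ab: "P a b" and bc: "P b c" and le: "a \<le> b" "b \<le> c"
    show "P a c"
      unfolding P_def
    proof
      assume in01: "0 \<le> a \<and> a \<le> c \<and> c \<le> 1"
      obtain \<sigma> where \<sigma>: "bij_betw \<sigma> (fibre C \<pi> (\<gamma> a)) (fibre C \<pi> (\<gamma> b))"
        "\<And>y. y \<in> fibre C \<pi> (\<gamma> a) \<Longrightarrow> \<exists>\<eta>. continuous_on {a..b} \<eta> \<and>
          (\<forall>t\<in>{a..b}. \<eta> t \<in> C \<and> \<pi> (\<eta> t) = \<gamma> t) \<and> \<eta> a = y \<and> \<eta> b = \<sigma> y"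
        "\<forall>s\<in>S. \<sigma> (s a) = s b"
        using ab in01 le unfolding P_def by auto
      obtain \<tau> where \<tau>: "bij_betw \<tau> (fibre C \<pi> (\<gamma> b)) (fibre C \<pi> (\<gamma> c))"
        "\<And>y. y \<in> fibre C \<pi> (\<gamma> b) \<Longrightarrow> \<exists>\<eta>. continuous_on {b..c} \<eta> \<and>
          (\<forall>t\<in>{b..c}. \<eta> t \<in> C \<and> \<pi> (\<eta> t) = \<gamma> t) \<and> \<eta> b = y \<and> \<eta> c = \<tau> y"
        "\<forall>s\<in>S. \<tau> (s b) = s c"
        using bc in01 le unfolding P_def by auto
      have "\<exists>\<eta>. continuous_on {a..c} \<eta> \<and>
          (\<forall>t\<in>{a..c}. \<eta> t \<in> C \<and> \<pi> (\<eta> t) = \<gamma> t) \<and> \<eta> a = y \<and> \<eta> c = (\<tau> \<circ> \<sigma>) y"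
        if y: "y \<in> fibre C \<pi> (\<gamma> a)" for y
      proof -
        obtain \<eta> where \<eta>: "continuous_on {a..b} \<eta>" "\<forall>t\<in>{a..b}. \<eta> t \<in> C \<and> \<pi> (\<eta> t) = \<gamma> t"
          "\<eta> a = y" "\<eta> b = \<sigma> y"
          using \<sigma>(2)[OF y] by blast
        have "\<sigma> y \<in> fibre C \<pi> (\<gamma> b)"
          using \<sigma>(1) y by (auto simp: bij_betw_def)
        then obtain \<theta> where \<theta>: "continuous_on {b..c} \<theta>" "\<forall>t\<in>{b..c}. \<theta> t \<in> C \<and> \<pi> (\<theta> t) = \<gamma> t"
          "\<theta> b = \<sigma> y" "\<theta> c = \<tau> (\<sigma> y)"
          using \<tau>(2) by blast
        define \<zeta> where "\<zeta> t = (if t \<le> b then \<eta> t else \<theta> t)" for t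
        have ab_bc: "{a..c} = {a..b} \<union> {b..c}"
          using le by auto
        have "continuous_on ({a..b} \<union> {b..c}) \<zeta>"
          unfolding \<zeta>_def using \<eta> \<theta> le
          by (intro continuous_on_If) auto
        then show ?thesis
          using \<eta> \<theta> le ab_bc
          by (intro exI[of _ \<zeta>]) (auto simp: \<zeta>_def)
      qed
      then show "\<exists>\<sigma>. bij_betw \<sigma> (fibre C \<pi> (\<gamma> a)) (fibre C \<pi> (\<gamma> c)) \<and>
       (\<forall>y \<in> fibre C \<pi> (\<gamma> a). \<exists>\<eta>. continuous_on {a..c} \<eta> \<and>
          (\<forall>t\<in>{a..c}. \<eta> t \<in> C \<and> \<pi> (\<eta> t) = \<gamma> t) \<and> \<eta> a = y \<and> \<eta> c = \<sigma> y) \<and>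
       (\<forall>s\<in>S. \<sigma> (s a) = s c)"
        using bij_betw_trans[OF \<sigma>(1) \<tau>(1)] \<sigma>(3) \<tau>(3) by (intro exI[of _ "\<tau> \<circ> \<sigma>"]) auto
    qed
  next
    fix x :: real
    assume x: "0 \<le> x" "x \<le> 1"
    then have "\<gamma> x \<in> U"
      using \<gamma>U by auto
    (* An evenly covered neighbourhood T of \<open>\<gamma> x\<close> with its sheets and the inverses q of the projection on them. *)
    then obtain T \<V> where T: "\<gamma> x \<in> T" "openin (top_of_set U) T" "\<Union>\<V> = C \<inter> \<pi> -` T"
      "\<forall>V\<in>\<V>. openin (top_of_set C) V" "pairwise disjnt \<V>" "\<forall>V\<in>\<V>. \<exists>q. homeomorphism V T \<pi> q"
      using cov unfolding covering_space_def by metis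
    then obtain q where q: "\<And>V. V \<in> \<V> \<Longrightarrow> homeomorphism V T \<pi> (q V)"
      by metis
    have q_in: "q V p \<in> V" "q V p \<in> C" "\<pi> (q V p) = p" if "V \<in> \<V>" "p \<in> T" for V p
      using q[OF that(1)] that T(3) unfolding homeomorphism_def by blast+
    have q_\<pi>: "q V (\<pi> y) = y" if "V \<in> \<V>" "y \<in> V" for V y
      using q[OF that(1)] that unfolding homeomorphism_def by blast
    have same_sheet: "V = V'" if "V \<in> \<V>" "V' \<in> \<V>" "y \<in> V" "y \<in> V'" for V V' y
      using T(5) that unfolding pairwise_def disjnt_def by blast
    have "\<exists>V. V \<in> \<V> \<and> s x \<in> V" if "s \<in> S" for s
    proof -
      have "s x \<in> \<Union>\<V>"
        using S[OF that] x T(1) unfolding T(3) by simp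
      then show ?thesis by blast
    qed
    then obtain sh where sh: "\<And>s. s \<in> S \<Longrightarrow> sh s \<in> \<V> \<and> s x \<in> sh s"
      by metis
    (* Up to a small distance d from x, the path stays in T and each section stays in its sheet. *)
    have near: "\<forall>\<^sub>F t in at x within {0..1}. f t \<in> V"
      if "openin (top_of_set D) V" "continuous_on {0..1} f" "f x \<in> V" "\<And>t. t \<in> {0..1} \<Longrightarrow> f t \<in> D"
      for f :: "real \<Rightarrow> 'z::topological_space" and V D
    proof -
      from that(1) obtain O' where O': "open O'" "V = D \<inter> O'"
        unfolding openin_open by blast
      have "(f \<longlongrightarrow> f x) (at x within {0..1})"
        using that(2) x by (auto simp: continuous_on_def)
      then have "\<forall>\<^sub>F t in at x within {0..1}. f t \<in> O'"
        using O' that(3) by (intro topological_tendstoD) auto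
      moreover have "\<forall>\<^sub>F t in at x within {0..1}. t \<in> {0..1}"
        by (simp add: eventually_at_filter)
      ultimately show ?thesis
        by eventually_elim (use O'(2) that(4) in blast)
    qed
    have "\<forall>\<^sub>F t in at x within {0..1}. \<gamma> t \<in> T"
      using near[OF T(2) cont\<gamma> T(1)] \<gamma>U by blast
    moreover have "\<forall>\<^sub>F t in at x within {0..1}. \<forall>s\<in>S. s t \<in> sh s"
    proof (rule eventually_ball_finite[OF fin], rule ballI)
      fix s assume s: "s \<in> S"
      show "\<forall>\<^sub>F t in at x within {0..1}. s t \<in> sh s"
        using S[OF s] sh[OF s] T(4) by (intro near[of C]) auto
    qed
    ultimately have "\<forall>\<^sub>F t in at x within {0..1}. \<gamma> t \<in> T \<and> (\<forall>s\<in>S. s t \<in> sh s)"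
      by (rule eventually_conj)
    then obtain d where d: "d > 0"
      and d': "\<forall>t\<in>{0..1}. t \<noteq> x \<and> dist t x < d \<longrightarrow> \<gamma> t \<in> T \<and> (\<forall>s\<in>S. s t \<in> sh s)"
      by (auto simp: eventually_at)
    then have d': "\<gamma> t \<in> T \<and> (\<forall>s\<in>S. s t \<in> sh s)" if "t \<in> {0..1}" "dist t x < d" for t
      using that T(1) sh by (cases "t = x") auto
    have "P a b" if "a \<le> x" "x \<le> b" "b - a < d" for a b
      unfolding P_def
    proof
      assume in01: "0 \<le> a \<and> a \<le> b \<and> b \<le> 1"
      have loc: "\<gamma> t \<in> T \<and> (\<forall>s\<in>S. s t \<in> sh s)" if "t \<in> {a..b}" for t
        by (rule d') (use \<open>a \<le> x\<close> \<open>x \<le> b\<close> \<open>b - a < d\<close> in01 that in \<open>auto simp: dist_real_def\<close>)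
      define sheet where "sheet y = (THE V. V \<in> \<V> \<and> y \<in> V)" for y
      have sheet_eq: "sheet y = V" if "V \<in> \<V>" "y \<in> V" for V y
        unfolding sheet_def using that same_sheet by (intro the_equality) auto
      have sheet: "sheet y \<in> \<V> \<and> y \<in> sheet y" if "y \<in> C" "\<pi> y \<in> T" for y
      proof -
        have "y \<in> \<Union>\<V>"
          using that T(3) by blast
        then show ?thesis
          using sheet_eq by auto
      qed
      have ends: "\<gamma> a \<in> T" "\<gamma> b \<in> T"
        using loc in01 by auto
      (* Transport keeps a point in its sheet; transport backwards is inverse to it. *)
      define \<sigma> where "\<sigma> y = q (sheet y) (\<gamma> b)" for y
      define \<tau> where "\<tau> y = q (sheet y) (\<gamma> a)" for y
      have bij: "bij_betw \<sigma> (fibre C \<pi> (\<gamma> a)) (fibre C \<pi> (\<gamma> b))"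
      proof (rule bij_betw_byWitness[where f' = \<tau>])
        show "\<forall>y\<in>fibre C \<pi> (\<gamma> a). \<tau> (\<sigma> y) = y"
        proof
          fix y assume y: "y \<in> fibre C \<pi> (\<gamma> a)"
          then have V: "sheet y \<in> \<V>" "y \<in> sheet y"
            using sheet ends by (auto simp: fibre_def)
          then have "sheet (\<sigma> y) = sheet y"
            unfolding \<sigma>_def using q_in(1) ends by (intro sheet_eq) auto
          then show "\<tau> (\<sigma> y) = y"
            unfolding \<tau>_def using q_\<pi>[OF V] y by (simp add: fibre_def)
        qed
        show "\<forall>y\<in>fibre C \<pi> (\<gamma> b). \<sigma> (\<tau> y) = y"
        proof
          fix y assume y: "y \<in> fibre C \<pi> (\<gamma> b)"
          then have V: "sheet y \<in> \<V>" "y \<in> sheet y"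
            using sheet ends by (auto simp: fibre_def)
          then have "sheet (\<tau> y) = sheet y"
            unfolding \<tau>_def using q_in(1) ends by (intro sheet_eq) auto
          then show "\<sigma> (\<tau> y) = y"
            unfolding \<sigma>_def using q_\<pi>[OF V] y by (simp add: fibre_def)
        qed
        show "\<sigma> ` fibre C \<pi> (\<gamma> a) \<subseteq> fibre C \<pi> (\<gamma> b)" "\<tau> ` fibre C \<pi> (\<gamma> b) \<subseteq> fibre C \<pi> (\<gamma> a)"
          using sheet q_in ends by (auto simp: \<sigma>_def \<tau>_def fibre_def)
      qed
      have lifts: "\<exists>\<eta>. continuous_on {a..b} \<eta> \<and>
          (\<forall>t\<in>{a..b}. \<eta> t \<in> C \<and> \<pi> (\<eta> t) = \<gamma> t) \<and> \<eta> a = y \<and> \<eta> b = \<sigma> y"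
        if y: "y \<in> fibre C \<pi> (\<gamma> a)" for y
      proof -
        have V: "sheet y \<in> \<V>" "y \<in> sheet y"
          using sheet ends y by (auto simp: fibre_def)
        have "continuous_on T (q (sheet y))"
          using q[OF V(1)] by (simp add: homeomorphism_def)
        moreover have "continuous_on {a..b} \<gamma>"
          using cont\<gamma> in01 by (auto intro: continuous_on_subset)
        ultimately have "continuous_on {a..b} (\<lambda>t. q (sheet y) (\<gamma> t))"
          by (rule continuous_on_compose2) (use loc in auto)
        then show ?thesis
          using q_in[OF V(1)] q_\<pi>[OF V] y loc
          by (intro exI[of _ "\<lambda>t. q (sheet y) (\<gamma> t)"]) (auto simp: \<sigma>_def fibre_def)
      qed
      have sections: "\<sigma> (s a) = s b" if s: "s \<in> S" for s
      proof -
        have "sheet (s a) = sh s"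
          using sh[OF s] loc[of a] s in01 by (intro sheet_eq) auto
        moreover have "q (sh s) (\<pi> (s b)) = s b"
          using sh[OF s] loc[of b] s in01 by (intro q_\<pi>) auto
        ultimately show ?thesis
          using S[OF s] in01 by (simp add: \<sigma>_def)
      qed
      show "\<exists>\<sigma>. bij_betw \<sigma> (fibre C \<pi> (\<gamma> a)) (fibre C \<pi> (\<gamma> b)) \<and>
       (\<forall>y \<in> fibre C \<pi> (\<gamma> a). \<exists>\<eta>. continuous_on {a..b} \<eta> \<and>
          (\<forall>t\<in>{a..b}. \<eta> t \<in> C \<and> \<pi> (\<eta> t) = \<gamma> t) \<and> \<eta> a = y \<and> \<eta> b = \<sigma> y) \<and>
       (\<forall>s\<in>S. \<sigma> (s a) = s b)"
        by (intro exI[of _ \<sigma>] conjI ballI) (rule bij | erule lifts | erule sections)+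
    qed
    then show "\<exists>d>0. \<forall>a b. a \<le> x \<and> x \<le> b \<and> b - a < d \<longrightarrow> P a b"
      using d by blast
  qed auto
  then obtain \<sigma> where \<sigma>: "bij_betw \<sigma> (fibre C \<pi> (\<gamma> 0)) (fibre C \<pi> (\<gamma> 1))"
    "\<And>y. y \<in> fibre C \<pi> (\<gamma> 0) \<Longrightarrow> \<exists>\<eta>. continuous_on {0..1} \<eta> \<and>
       (\<forall>t\<in>{0..1}. \<eta> t \<in> C \<and> \<pi> (\<eta> t) = \<gamma> t) \<and> \<eta> 0 = y \<and> \<eta> 1 = \<sigma> y"
    "\<And>s. s \<in> S \<Longrightarrow> \<sigma> (s 0) = s 1"
    unfolding P_def by auto
  show thesis
  proof (rule that[of \<sigma>])
    fix y assume "y \<in> fibre C \<pi> (pathstart \<gamma>)"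
    then obtain \<eta> where "continuous_on {0..1} \<eta>"
       "\<forall>t\<in>{0..1}. \<eta> t \<in> C \<and> \<pi> (\<eta> t) = \<gamma> t" "\<eta> 0 = y" "\<eta> 1 = \<sigma> y"
      using \<sigma>(2)[of y] by (auto simp: pathstart_def)
    then show "lift_joins C \<pi> \<gamma> y (\<sigma> y)"
      unfolding lift_joins_def path_def path_image_def pathstart_def pathfinish_def by blast
  qed (use \<sigma> in \<open>auto simp: pathstart_def pathfinish_def\<close>)
qed

lemma monodromy_group_id:
  assumes "p \<in> U"
  shows "id \<in> monodromy_group Y \<pi> U p"
proof -
  have "\<exists>\<eta>. path \<eta> \<and> path_image \<eta> \<subseteq> Y \<and> (\<forall>t\<in>{0..1}. \<pi> (\<eta> t) = (\<lambda>_. p) t) \<and>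
    pathstart \<eta> = y \<and> pathfinish \<eta> = id y" if "y \<in> fibre Y \<pi> p" for y
    using that by (intro exI[of _ "\<lambda>_. y"])
      (auto simp: fibre_def path_def path_image_def pathstart_def pathfinish_def)
  moreover have "path (\<lambda>_::real. p)" "path_image (\<lambda>_::real. p) \<subseteq> U"
    "pathstart (\<lambda>_::real. p) = p" "pathfinish (\<lambda>_::real. p) = p"
    using assms by (auto simp: path_def path_image_def pathstart_def pathfinish_def)
  ultimately show ?thesis
    unfolding monodromy_group_def using permutes_id by blast
qed

lemma monodromy_group_iff:
  "\<sigma> \<in> monodromy_group Y \<pi> U p \<longleftrightarrow> \<sigma> permutes fibre Y \<pi> p \<and>
     (\<exists>\<gamma>. path \<gamma> \<and> path_image \<gamma> \<subseteq> U \<and> pathstart \<gamma> = p \<and> pathfinish \<gamma> = p \<and>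
       (\<forall>y \<in> fibre Y \<pi> p. lift_joins Y \<pi> \<gamma> y (\<sigma> y)))"
  unfolding monodromy_group_def lift_joins_def by simp

lemma monodromy_group_comp:
  assumes "\<sigma> \<in> monodromy_group Y \<pi> U p" "\<tau> \<in> monodromy_group Y \<pi> U p"
  shows "\<tau> \<circ> \<sigma> \<in> monodromy_group Y \<pi> U p"
proof -
  obtain \<gamma> where \<gamma>: "\<sigma> permutes fibre Y \<pi> p" "path \<gamma>" "path_image \<gamma> \<subseteq> U"
    "pathstart \<gamma> = p" "pathfinish \<gamma> = p" "\<forall>y \<in> fibre Y \<pi> p. lift_joins Y \<pi> \<gamma> y (\<sigma> y)"
    using assms(1) unfolding monodromy_group_iff by blast
  obtain \<delta> where \<delta>: "\<tau> permutes fibre Y \<pi> p" "path \<delta>" "path_image \<delta> \<subseteq> U"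
    "pathstart \<delta> = p" "pathfinish \<delta> = p" "\<forall>y \<in> fibre Y \<pi> p. lift_joins Y \<pi> \<delta> y (\<tau> y)"
    using assms(2) unfolding monodromy_group_iff by blast
  have "\<sigma> y \<in> fibre Y \<pi> p" if "y \<in> fibre Y \<pi> p" for y
    using permutes_in_image[OF \<gamma>(1)] that by simp
  then have "\<forall>y \<in> fibre Y \<pi> p. lift_joins Y \<pi> (\<gamma> +++ \<delta>) y ((\<tau> \<circ> \<sigma>) y)"
    using \<gamma>(6) \<delta>(6) by (auto intro: lift_joins_joinpaths)
  moreover have "path_image (\<gamma> +++ \<delta>) \<subseteq> U"
    using \<gamma> \<delta> by (simp add: path_image_join)
  moreover have "path (\<gamma> +++ \<delta>)" "pathstart (\<gamma> +++ \<delta>) = p" "pathfinish (\<gamma> +++ \<delta>) = p"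
    using \<gamma>(2-5) \<delta>(2-5) by simp_all
  ultimately show ?thesis
    unfolding monodromy_group_iff using permutes_compose[OF \<gamma>(1) \<delta>(1)] by blast
qed

text \<open>
  Lifts concatenate, so the monodromy group is closed under composition, and transpositions
  generate the symmetric group of a finite set.
\<close>

lemma monodromy_group_full_if_transpositions:
  assumes "p \<in> U" "finite (fibre Y \<pi> p)"
    and "\<And>y z. y \<in> fibre Y \<pi> p \<Longrightarrow> z \<in> fibre Y \<pi> p \<Longrightarrow> y \<noteq> z
      \<Longrightarrow> Transposition.transpose y z \<in> monodromy_group Y \<pi> U p"
  shows "monodromy_group Y \<pi> U p = {\<sigma>. \<sigma> permutes fibre Y \<pi> p}"
proof
  show "{\<sigma>. \<sigma> permutes fibre Y \<pi> p} \<subseteq> monodromy_group Y \<pi> U p"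
  proof
    fix \<sigma> assume "\<sigma> \<in> {\<sigma>. \<sigma> permutes fibre Y \<pi> p}"
    then have "\<sigma> permutes fibre Y \<pi> p" by simp
    then show "\<sigma> \<in> monodromy_group Y \<pi> U p"
    proof (rule permutes_induct[where P = "\<lambda>\<tau>. \<tau> \<in> monodromy_group Y \<pi> U p", OF _ assms(2)])
      show "id \<in> monodromy_group Y \<pi> U p"
        by (rule monodromy_group_id[OF assms(1)])
    next
      fix a b \<tau>
      assume "a \<in> fibre Y \<pi> p" "b \<in> fibre Y \<pi> p" "a \<noteq> b" "\<tau> \<in> monodromy_group Y \<pi> U p"
      then show "Transposition.transpose a b \<circ> \<tau> \<in> monodromy_group Y \<pi> U p"
        by (simp add: monodromy_group_comp assms(3))
    qed
  qed
qed (auto simp: monodromy_group_def)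

section \<open>Points of the projective line\<close>

lemma same_line_iff:
  "same_line v w \<longleftrightarrow> v \<noteq> 0 \<and> w \<noteq> 0 \<and> fst v * snd w = snd v * fst w"
proof
  assume "same_line v w"
  then show "v \<noteq> 0 \<and> w \<noteq> 0 \<and> fst v * snd w = snd v * fst w"
    by (auto simp: same_line_def zero_prod_def prod_eq_iff)
next
  assume vw: "v \<noteq> 0 \<and> w \<noteq> 0 \<and> fst v * snd w = snd v * fst w"
  show "same_line v w"
  proof (cases "fst v = 0")
    case True
    then have "snd v \<noteq> 0" "fst w = 0" "snd w \<noteq> 0"
      using vw by (auto simp: prod_eq_iff)
    then show ?thesis
      using vw True by (auto simp: same_line_def prod_eq_iff intro!: exI[of _ "snd w / snd v"])
  next
    case False
    then have "fst w \<noteq> 0"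
      using vw by (auto simp: prod_eq_iff)
    then show ?thesis
      using vw False by (auto simp: same_line_def prod_eq_iff field_simps intro!: exI[of _ "fst w / fst v"])
  qed
qed

lemma abs_cp1_eq_iff:
  assumes "v \<noteq> 0" "w \<noteq> 0"
  shows "abs_cp1 v = abs_cp1 w \<longleftrightarrow> fst v * snd w = snd v * fst w"
  using Quotient3_rel[OF Quotient3_cp1, of v w] assms by (auto simp: same_line_iff)

lemma cp1_cases:
  obtains v where "v \<noteq> 0" "q = abs_cp1 v"
proof -
  have "\<exists>v. v \<noteq> 0 \<and> q = abs_cp1 v"
    by (induction q rule: cp1.abs_induct) (auto simp: same_line_iff)
  then show thesis
    using that by blast
qed

lemma discriminant_vanishes_abs_cp1:
  assumes "v \<noteq> 0"
  shows "discriminant_vanishes E (abs_cp1 v) \<longleftrightarrow> discriminant E v = 0"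
  by (rule discriminant_vanishes.abs_eq) (use assms in \<open>auto simp: same_line_iff\<close>)

lemma continuous_on_abs_cp1: "continuous_on (- {0}) abs_cp1"
proof (subst continuous_on_open_vimage)
  show "open (- {0 :: complex \<times> complex})"
    by (simp add: open_Compl)
  have "abs_cp1 -` W \<inter> - {0} = {v. v \<noteq> 0 \<and> abs_cp1 v \<in> W}" for W
    by auto
  then show "\<forall>W. open W \<longrightarrow> open (abs_cp1 -` W \<inter> - {0})"
    by (simp add: open_cp1_def)
qed

definition affine_point :: "complex \<Rightarrow> cp1" where
  "affine_point z = abs_cp1 (z, 1)"

lemma pair_one_nonzero [simp]: "(z, 1 :: complex) \<noteq> 0" "(1 :: complex, z) \<noteq> 0"
  by (auto simp: prod_eq_iff)

lemma affine_point_eq_iff [simp]: "affine_point z = affine_point w \<longleftrightarrow> z = w"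
  unfolding affine_point_def by (subst abs_cp1_eq_iff) auto

lemma abs_cp1_eq_affine_point:
  assumes "snd v \<noteq> 0"
  shows "abs_cp1 v = affine_point (fst v / snd v)"
proof -
  have "v \<noteq> 0"
    using assms by auto
  then show ?thesis
    unfolding affine_point_def using assms by (subst abs_cp1_eq_iff) auto
qed

lemma abs_cp1_in_affine_image_iff:
  assumes "v \<noteq> 0"
  shows "abs_cp1 v \<in> affine_point ` D \<longleftrightarrow> snd v \<noteq> 0 \<and> fst v / snd v \<in> D"
proof (cases "snd v = 0")
  case True
  then have "abs_cp1 v \<noteq> affine_point z" for z
    unfolding affine_point_def using assms by (subst abs_cp1_eq_iff) (auto simp: prod_eq_iff)
  then show ?thesis
    using True by auto
next
  case False
  then show ?thesis
    by (auto simp: abs_cp1_eq_affine_point)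
qed

lemma open_affine_image:
  assumes "open D"
  shows "open (affine_point ` D)"
proof -
  have "continuous_on {v. snd v \<noteq> (0::complex)} (\<lambda>v. fst v / snd v)"
    by (intro continuous_intros) auto
  moreover have "open {v :: complex \<times> complex. snd v \<noteq> 0}"
    by (intro open_Collect_neq continuous_intros)
  ultimately have "open ((\<lambda>v. fst v / snd v) -` D \<inter> {v. snd v \<noteq> (0::complex)})"
    using assms continuous_on_open_vimage by blast
  moreover have "(\<lambda>v. fst v / snd v) -` D \<inter> {v. snd v \<noteq> (0::complex)}
    = {v. v \<noteq> 0 \<and> abs_cp1 v \<in> affine_point ` D}"
    by (auto simp: set_eq_iff abs_cp1_in_affine_image_iff simp del: image_iff split_paired_All cong: conj_cong)
  ultimately show ?thesis
    by (simp add: open_cp1_def)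
qed

lemma continuous_on_affine_point: "continuous_on D affine_point"
  unfolding affine_point_def
  by (rule continuous_on_compose2[OF continuous_on_abs_cp1]) (auto intro!: continuous_intros)

section \<open>Binary forms as polynomials of bounded degree\<close>

text \<open>
  A binary form of degree \<open>n\<close> is handled through its dehomogenization, a polynomial \<open>P\<close> with
  \<open>degree P \<le> n\<close>; the form is then \<open>binary_form n (coeff P)\<close>. A drop of the degree below \<open>n\<close> is
  a zero at infinity, so the bound \<open>n\<close> has to be carried along.
\<close>

definition form_poly :: "nat \<Rightarrow> (nat \<Rightarrow> complex) \<Rightarrow> complex poly" where
  "form_poly n c = (\<Sum>i\<le>n. monom (c i) i)"

lemma coeff_form_poly: "coeff (form_poly n c) i = (if i \<le> n then c i else 0)"
  by (auto simp: form_poly_def coeff_sum)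

lemma degree_form_poly: "degree (form_poly n c) \<le> n"
  by (rule degree_le) (simp add: coeff_form_poly)

lemma form_poly_coeff:
  assumes "degree P \<le> n"
  shows "form_poly n (coeff P) = P"
  using assms by (intro poly_eqI) (auto simp: coeff_form_poly coeff_eq_0)

lemma form_poly_cong:
  "(\<And>i. i \<le> n \<Longrightarrow> c i = d i) \<Longrightarrow> form_poly n c = form_poly n d"
  by (simp add: form_poly_def)

lemma binary_form_form_poly: "binary_form n (coeff (form_poly n c)) v = binary_form n c v"
  by (simp add: binary_form_def coeff_form_poly)

lemma binary_form_affine:
  assumes "degree P \<le> n"
  shows "binary_form n (coeff P) (z, 1) = poly P z"
proof -
  have "poly P z = poly (form_poly n (coeff P)) z"
    by (simp add: form_poly_coeff assms)
  then show ?thesis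
    by (simp add: binary_form_def form_poly_def poly_sum poly_monom)
qed

lemma binary_form_infinity: "binary_form n c (s, 0) = c n * s ^ n"
proof -
  have "binary_form n c (s, 0) = (\<Sum>i\<le>n. if i = n then c n * s ^ n else 0)"
    unfolding binary_form_def by (intro sum.cong) auto
  then show ?thesis
    by simp
qed

lemma binary_form_homogenize:
  assumes "degree P \<le> n" "t \<noteq> 0"
  shows "binary_form n (coeff P) (s, t) = t ^ n * poly P (s / t)"
  using binary_form_scale[of n "coeff P" t "(s / t, 1)"] binary_form_affine[OF assms(1)] assms(2)
  by simp

lemma coeff_mult_top:
  fixes P Q :: "'a::comm_semiring_0 poly"
  assumes "degree P \<le> m" "degree Q \<le> n"
  shows "coeff (P * Q) (m + n) = coeff P m * coeff Q n"
proof -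
  have "coeff P i * coeff Q (m + n - i) = (if i = m then coeff P m * coeff Q n else 0)" for i
    using assms by (cases "i < m"; cases "i = m") (auto simp: coeff_eq_0)
  then show ?thesis
    by (simp add: coeff_mult)
qed

text \<open>
  Away from infinity both sides are homogenized values of polynomials; at infinity only the
  coefficients of top degree survive.
\<close>

lemma binary_form_mult:
  assumes "degree P \<le> m" "degree Q \<le> n"
  shows "binary_form (m + n) (coeff (P * Q)) v = binary_form m (coeff P) v * binary_form n (coeff Q) v"
proof -
  obtain s t where v: "v = (s, t)"
    by (cases v)
  have "degree (P * Q) \<le> m + n"
    using degree_mult_le[of P Q] assms by simp
  then show ?thesis
    using assms by (cases "t = 0")
      (auto simp: v binary_form_infinity coeff_mult_top binary_form_homogenize power_add)
qed

lemma binary_form_add: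
  "binary_form n (coeff (P + Q)) v = binary_form n (coeff P) v + binary_form n (coeff Q) v"
  by (simp add: binary_form_def sum.distrib algebra_simps)

lemma binary_form_smult:
  "binary_form n (coeff (smult a P)) v = a * binary_form n (coeff P) v"
  by (simp add: binary_form_def sum_distrib_left mult.assoc)

lemma binary_form_power:
  assumes "degree P \<le> m"
  shows "binary_form (k * m) (coeff (P ^ k)) v = binary_form m (coeff P) v ^ k"
proof (induction k)
  case 0
  then show ?case
    by (simp add: binary_form_def)
next
  case (Suc k)
  have "degree (P ^ k) \<le> k * m"
    using degree_power_le[of P k] assms by (metis mult.commute mult_le_mono1 order_trans)
  then show ?case
    using binary_form_mult[OF assms, of "P ^ k" "k * m" v] Suc by simp
qed

text \<open>
  The form of degree 1 that vanishes at the point \<open>w\<close>, here \<open>w = [s : t]\<close> with affine coordinate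
  \<open>s / t\<close>; for \<open>t = 0\<close> the polynomial is constant.
\<close>

definition linear_form :: "complex \<times> complex \<Rightarrow> complex poly" where
  "linear_form w = [:- fst w, snd w:]"

lemma coeff_linear_form:
  "coeff (linear_form w) k = (if k = 0 then - fst w else if k = 1 then snd w else 0)"
  by (auto simp: linear_form_def coeff_pCons split: nat.split)

lemma degree_linear_form: "degree (linear_form w) \<le> 1"
  by (auto simp: linear_form_def)

lemma binary_form_linear_form:
  "binary_form 1 (coeff (linear_form w)) v = fst v * snd w - fst w * snd v"
  by (simp add: binary_form_def linear_form_def)

text \<open>
  Division with a possibly infinite zero: if \<open>w\<close> is the point at infinity, then vanishing there
  lowers the degree of \<open>P\<close>, and \<open>linear_form w\<close> is a nonzero constant.
\<close>

lemma linear_form_dvd: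
  assumes deg: "degree P \<le> Suc n" and w: "w \<noteq> 0"
    and vanish: "binary_form (Suc n) (coeff P) w = 0"
  obtains Q where "degree Q \<le> n" "P = linear_form w * Q"
proof (cases "snd w = 0")
  case True
  then have "fst w \<noteq> 0"
    using w by (auto simp: prod_eq_iff)
  moreover have "binary_form (Suc n) (coeff P) w = coeff P (Suc n) * fst w ^ Suc n"
    using binary_form_infinity[of "Suc n" "coeff P" "fst w"] True by (metis prod.collapse)
  ultimately have "coeff P (Suc n) = 0"
    using vanish by auto
  then have "degree P \<le> n"
    using deg by (metis le_SucE leading_coeff_0_iff degree_0 le0)
  then show thesis
    using that[of "smult (inverse (- fst w)) P"] True \<open>fst w \<noteq> 0\<close>
    by (simp add: linear_form_def)
next
  case False
  then have "poly P (fst w / snd w) = 0"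
    using vanish binary_form_homogenize[OF deg False, of "fst w"] by simp
  then have "[:- (fst w / snd w), 1:] dvd P"
    by (simp add: poly_eq_0_iff_dvd)
  then obtain R where R: "P = [:- (fst w / snd w), 1:] * R"
    by (elim dvdE)
  have "degree R \<le> n"
  proof (cases "R = 0")
    case False
    then have "degree P = 1 + degree R"
      unfolding R by (subst degree_mult_eq) auto
    then show ?thesis
      using deg by simp
  qed simp
  moreover have "P = linear_form w * smult (inverse (snd w)) R"
  proof -
    have "linear_form w = smult (snd w) [:- (fst w / snd w), 1:]"
      using False by (simp add: linear_form_def)
    then have "linear_form w * smult (inverse (snd w)) R
      = smult (inverse (snd w) * snd w) ([:- (fst w / snd w), 1:] * R)"
      by (simp only: mult_smult_left mult_smult_right smult_smult)
    then show ?thesis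
      using False by (simp add: R)
  qed
  ultimately show thesis
    using that[of "smult (inverse (snd w)) R"] by simp
qed

lemma two_linear_forms_dvd:
  assumes deg: "degree P \<le> Suc (Suc n)"
    and v: "v \<noteq> 0" "binary_form (Suc (Suc n)) (coeff P) v = 0"
    and w: "w \<noteq> 0" "binary_form (Suc (Suc n)) (coeff P) w = 0"
    and cross: "fst v * snd w \<noteq> snd v * fst w"
  obtains Q where "degree Q \<le> n" "P = linear_form v * linear_form w * Q"
proof -
  obtain R where R: "degree R \<le> Suc n" "P = linear_form v * R"
    using linear_form_dvd[OF deg v] .
  have "binary_form (1 + Suc n) (coeff P) w
    = (fst w * snd v - fst v * snd w) * binary_form (Suc n) (coeff R) w"
    unfolding R(2) by (subst binary_form_mult[OF degree_linear_form R(1)]) (simp only: binary_form_linear_form)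
  then have "binary_form (Suc n) (coeff R) w = 0"
    using w(2) cross by (auto simp: mult.commute)
  then obtain Q where "degree Q \<le> n" "R = linear_form w * Q"
    using linear_form_dvd[OF R(1) w(1)] by blast
  then show thesis
    using that R(2) by (metis mult.assoc)
qed

section \<open>The discriminant polynomial\<close>

definition discriminant_poly :: "complex poly \<Rightarrow> complex poly \<Rightarrow> complex poly" where
  "discriminant_poly P Q = smult 4 (P ^ 3) + smult 27 (Q ^ 2)"

definition poly_A :: "weierstrass \<Rightarrow> complex poly" where
  "poly_A E = form_poly 8 (\<lambda>i. fst E $ of_nat i)"

definition poly_B :: "weierstrass \<Rightarrow> complex poly" where
  "poly_B E = form_poly 12 (\<lambda>i. snd E $ of_nat i)"

abbreviation disc_poly :: "weierstrass \<Rightarrow> complex poly" where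
  "disc_poly E \<equiv> discriminant_poly (poly_A E) (poly_B E)"

lemma degree_poly_A: "degree (poly_A E) \<le> 8" and degree_poly_B: "degree (poly_B E) \<le> 12"
  by (simp_all add: poly_A_def poly_B_def degree_form_poly)

lemma discriminant_eq:
  "discriminant E v = 4 * binary_form 8 (coeff (poly_A E)) v ^ 3 + 27 * binary_form 12 (coeff (poly_B E)) v ^ 2"
  by (cases E) (simp add: discriminant_def poly_A_def poly_B_def binary_form_form_poly)

lemma discriminant_eq_binary_form:
  "discriminant E v = binary_form 24 (coeff (disc_poly E)) v"
  using binary_form_power[OF degree_poly_A, of 3 E v] binary_form_power[OF degree_poly_B, of 2 E v]
  by (simp add: discriminant_eq discriminant_poly_def binary_form_add binary_form_smult)

lemma degree_disc_poly: "degree (disc_poly E) \<le> 24"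
proof -
  have "degree (poly_A E ^ 3) \<le> 24" "degree (poly_B E ^ 2) \<le> 24"
    using degree_power_le[of "poly_A E" 3] degree_power_le[of "poly_B E" 2]
      degree_poly_A[of E] degree_poly_B[of E] by linarith+
  then show ?thesis
    unfolding discriminant_poly_def by (intro degree_add_le) (auto intro: order_trans[OF degree_smult_le])
qed

lemma vanishes_affine_point: "discriminant_vanishes E (affine_point z) \<longleftrightarrow> poly (disc_poly E) z = 0"
  unfolding affine_point_def
  by (subst discriminant_vanishes_abs_cp1)
    (simp_all add: discriminant_eq_binary_form binary_form_affine degree_disc_poly)

text \<open>
  The coefficient of degree 24 is the value of the discriminant at infinity.
\<close>

lemma vanishes_imp_affine:
  assumes "coeff (disc_poly E) 24 \<noteq> 0" "discriminant_vanishes E q"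
  obtains z where "q = affine_point z" "poly (disc_poly E) z = 0"
proof -
  obtain v where v: "v \<noteq> 0" "q = abs_cp1 v"
    by (rule cp1_cases)
  have "snd v \<noteq> 0"
  proof
    assume "snd v = 0"
    then have "fst v \<noteq> 0" "v = (fst v, 0)"
      using v(1) by (auto simp: prod_eq_iff)
    then show False
      using assms v binary_form_infinity[of 24 "coeff (disc_poly E)" "fst v"]
      by (auto simp: discriminant_vanishes_abs_cp1 discriminant_eq_binary_form)
  qed
  then show thesis
    using that v assms(2) by (metis abs_cp1_eq_affine_point vanishes_affine_point)
qed


section \<open>Polynomials with coefficients in an algebra of functions\<close>

text \<open>
  Whether the coefficients of a polynomial depend polynomially on Weierstrass data, polynomially on
  the parameter of a complex line, or continuously on a point, is in each case a consequence of closure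
  under sums and products. The locale treats the three situations at once.
\<close>

locale function_algebra =
  fixes R :: "('x \<Rightarrow> complex) set"
  assumes const_mem: "(\<lambda>_. c) \<in> R"
    and add_mem: "f \<in> R \<Longrightarrow> g \<in> R \<Longrightarrow> (\<lambda>x. f x + g x) \<in> R"
    and mult_mem: "f \<in> R \<Longrightarrow> g \<in> R \<Longrightarrow> (\<lambda>x. f x * g x) \<in> R"
begin

lemma sum_mem:
  assumes "\<And>i. i \<in> I \<Longrightarrow> (\<lambda>x. f i x) \<in> R"
  shows "(\<lambda>x. \<Sum>i\<in>I. f i x) \<in> R"
  using assms by (induction I rule: infinite_finite_induct) (auto intro: const_mem add_mem)

lemma prod_mem:
  assumes "\<And>i. i \<in> I \<Longrightarrow> (\<lambda>x. f i x) \<in> R"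
  shows "(\<lambda>x. \<Prod>i\<in>I. f i x) \<in> R"
  using assms by (induction I rule: infinite_finite_induct) (auto intro: const_mem mult_mem)

lemma uminus_mem:
  assumes "f \<in> R"
  shows "(\<lambda>x. - f x) \<in> R"
  using mult_mem[OF const_mem[of "-1"] assms] by simp

lemma if_mem:
  assumes "b \<Longrightarrow> f \<in> R" "\<not> b \<Longrightarrow> g \<in> R"
  shows "(\<lambda>x. if b then f x else g x) \<in> R"
  using assms by (cases b) simp_all

definition coeffs_in :: "('x \<Rightarrow> complex poly) \<Rightarrow> bool" where
  "coeffs_in P \<longleftrightarrow> (\<forall>k. (\<lambda>x. coeff (P x) k) \<in> R)"

lemma coeffs_in_add: "coeffs_in P \<Longrightarrow> coeffs_in Q \<Longrightarrow> coeffs_in (\<lambda>x. P x + Q x)"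
  by (simp add: coeffs_in_def add_mem)

lemma coeffs_in_mult: "coeffs_in P \<Longrightarrow> coeffs_in Q \<Longrightarrow> coeffs_in (\<lambda>x. P x * Q x)"
  unfolding coeffs_in_def coeff_mult by (intro allI sum_mem mult_mem) simp_all

lemma coeffs_in_smult: "coeffs_in P \<Longrightarrow> coeffs_in (\<lambda>x. smult c (P x))"
  by (simp add: coeffs_in_def const_mem mult_mem)

lemma coeffs_in_const: "coeffs_in (\<lambda>x. P)"
  by (simp add: coeffs_in_def const_mem)

lemma coeffs_in_power: "coeffs_in P \<Longrightarrow> coeffs_in (\<lambda>x. P x ^ n)"
  by (induction n) (simp_all add: coeffs_in_const coeffs_in_mult)

lemma coeffs_in_form_poly:
  assumes "\<And>i. i \<le> n \<Longrightarrow> (\<lambda>x. c x i) \<in> R"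
  shows "coeffs_in (\<lambda>x. form_poly n (c x))"
  unfolding coeffs_in_def
proof
  fix k
  show "(\<lambda>x. coeff (form_poly n (c x)) k) \<in> R"
    using assms const_mem by (cases "k \<le> n") (simp_all add: coeff_form_poly)
qed

lemma coeffs_in_linear_form:
  assumes "f \<in> R" "g \<in> R"
  shows "coeffs_in (\<lambda>x. linear_form (f x, g x))"
  unfolding coeffs_in_def
proof
  fix k
  show "(\<lambda>x. coeff (linear_form (f x, g x)) k) \<in> R"
    using assms(2) const_mem[of 0] uminus_mem[OF assms(1)]
    by (cases "k = 0"; cases "k = 1") (simp_all add: coeff_linear_form)
qed

lemma coeffs_in_pderiv: "coeffs_in P \<Longrightarrow> coeffs_in (\<lambda>x. pderiv (P x))"
  unfolding coeffs_in_def coeff_pderiv by (auto intro!: mult_mem[OF const_mem])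

lemma coeffs_in_discriminant_poly:
  "coeffs_in P \<Longrightarrow> coeffs_in Q \<Longrightarrow> coeffs_in (\<lambda>x. discriminant_poly (P x) (Q x))"
  unfolding discriminant_poly_def by (intro coeffs_in_add coeffs_in_smult coeffs_in_power)

text \<open>
  The size of the Sylvester matrix must not depend on the point, hence the resultant with prescribed
  formal degrees; its Leibniz expansion is a polynomial in the coefficients.
\<close>

lemma resultant_sub_mem:
  assumes "coeffs_in P" "coeffs_in Q"
  shows "(\<lambda>x. resultant_sub m n (P x) (Q x)) \<in> R"
proof -
  have coeffs: "(\<lambda>x. coeff (P x) k) \<in> R" "(\<lambda>x. coeff (Q x) k) \<in> R" for k
    using assms unfolding coeffs_in_def by blast+
  have entry: "(\<lambda>x. sylvester_mat_sub m n (P x) (Q x) $$ (i, j)) \<in> R"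
    if "i < m + n" "j < m + n" for i j
    unfolding sylvester_mat_sub_index[OF that] by (intro if_mem coeffs const_mem)
  have "(\<lambda>x. \<Sum>\<pi> | \<pi> permutes {0..<m + n}. of_int (sign \<pi>) *
      (\<Prod>i = 0..<m + n. sylvester_mat_sub m n (P x) (Q x) $$ (i, \<pi> i))) \<in> R"
  proof (rule sum_mem, rule mult_mem[OF const_mem], rule prod_mem, rule entry)
    fix \<pi> i assume "\<pi> \<in> {\<pi>. \<pi> permutes {0..<m + n}}" "i \<in> {0..<m + n}"
    then show "i < m + n" "\<pi> i < m + n"
      using permutes_in_image[of \<pi> "{0..<m + n}" i] by simp_all
  qed
  then show ?thesis
    unfolding resultant_sub_def by (simp add: det_def'[OF sylvester_mat_sub_carrier])
qed

lemma polynomial_functions_comp_mem: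
  fixes \<psi> :: "'x \<Rightarrow> weierstrass"
  assumes f: "f \<in> polynomial_functions"
    and A: "\<And>i. (\<lambda>x. fst (\<psi> x) $ i) \<in> R" and B: "\<And>j. (\<lambda>x. snd (\<psi> x) $ j) \<in> R"
  shows "(\<lambda>x. f (\<psi> x)) \<in> R"
  using f by induction (auto intro: const_mem add_mem mult_mem A B)

end

interpretation poly_fun: function_algebra polynomial_functions
  by unfold_locales (auto intro: polynomial_functions.intros)

interpretation cont_fun: function_algebra "{f :: 'x::topological_space \<Rightarrow> complex. continuous_on UNIV f}"
  by unfold_locales (auto intro: continuous_intros)

lemma coeffs_in_disc_poly: "poly_fun.coeffs_in disc_poly"
  unfolding poly_A_def poly_B_def
  by (intro poly_fun.coeffs_in_discriminant_poly poly_fun.coeffs_in_form_poly polynomial_functions.intros)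

lemma polynomial_functions_continuous:
  assumes "f \<in> polynomial_functions"
  shows "continuous_on UNIV f"
  using assms by induction (auto intro!: continuous_intros)

section \<open>Roots of polynomials\<close>

lemma norm_poly_linear_factors:
  fixes A :: "complex multiset"
  assumes "\<epsilon> \<ge> 0" "\<And>a. a \<in># A \<Longrightarrow> \<epsilon> \<le> dist a z"
  shows "\<epsilon> ^ size A \<le> norm (poly (\<Prod>a\<in>#A. [:- a, 1:]) z)"
  using assms(2)
proof (induction A)
  case (add a A)
  then have "\<epsilon> * \<epsilon> ^ size A \<le> norm (z - a) * norm (poly (\<Prod>a\<in>#A. [:- a, 1:]) z)"
    using assms(1) by (intro mult_mono) (auto simp: dist_norm norm_minus_commute)
  then show ?case
    by (simp add: norm_mult[symmetric] algebra_simps)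
qed simp

text \<open>
  If all roots were at distance at least \<open>\<epsilon>\<close> from \<open>z\<close>, the factorization into linear factors would
  give \<open>norm (poly p z) \<ge> norm (coeff p n) * \<epsilon> ^ n\<close>.
\<close>

lemma root_within:
  fixes p :: "complex poly"
  assumes "degree p \<le> n" "coeff p n \<noteq> 0" "\<epsilon> > 0"
    and small: "norm (poly p z) < norm (coeff p n) * \<epsilon> ^ n"
  obtains w where "poly p w = 0" "dist w z < \<epsilon>"
proof -
  have n: "degree p = n" "p \<noteq> 0"
    using assms(1,2) le_degree by (auto intro: antisym)
  then obtain A where A: "size A = n" "p = smult (coeff p n) (\<Prod>a\<in>#A. [:- a, 1:])"
    using alg_closed_imp_factorization[of p] by auto
  have "\<exists>a\<in>#A. dist a z < \<epsilon>"
  proof (rule ccontr)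
    assume "\<not> (\<exists>a\<in>#A. dist a z < \<epsilon>)"
    then have "\<epsilon> ^ size A \<le> norm (poly (\<Prod>a\<in>#A. [:- a, 1:]) z)"
      using assms(3) by (intro norm_poly_linear_factors) (auto simp: not_less)
    then have "norm (coeff p n) * \<epsilon> ^ n \<le> norm (coeff p n) * norm (poly (\<Prod>a\<in>#A. [:- a, 1:]) z)"
      using A(1) by (intro mult_left_mono) auto
    also have "\<dots> = norm (poly p z)"
      by (subst (2) A(2)) (simp add: norm_mult)
    finally show False
      using small by simp
  qed
  then obtain a where a: "a \<in># A" "dist a z < \<epsilon>"
    by blast
  have "poly p a = 0"
    using a(1) by (subst A(2)) (auto simp: poly_prod_mset prod_mset_zero_iff)
  then show thesis
    using that a by blast
qed

text \<open>
  Half of the continuity of roots: every root persists. When the number of roots nearby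
  is bounded from above, it follows that no other root appears.
\<close>

lemma nearby_root:
  fixes P :: "'x::t2_space \<Rightarrow> complex poly"
  assumes cont: "cont_fun.coeffs_in P"
    and deg: "\<And>x. degree (P x) \<le> n" and lead: "coeff (P x0) n \<noteq> 0"
    and root: "poly (P x0) z = 0" and \<epsilon>: "\<epsilon> > 0"
  shows "\<forall>\<^sub>F x in nhds x0. \<exists>w. poly (P x) w = 0 \<and> dist w z < \<epsilon>"
proof -
  have lim: "((\<lambda>x. coeff (P x) k) \<longlongrightarrow> coeff (P x0) k) (nhds x0)" for k
  proof -
    have "continuous_on UNIV (\<lambda>x. coeff (P x) k)"
      using cont unfolding cont_fun.coeffs_in_def by blast
    then have "isCont (\<lambda>x. coeff (P x) k) x0"
      by (simp add: continuous_on_eq_continuous_at)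
    then show ?thesis
      using tendsto_at_iff_tendsto_nhds[of "\<lambda>x. coeff (P x) k" x0] by (simp add: isCont_def)
  qed
  have poly_eq: "poly (P x) z = (\<Sum>i\<le>n. coeff (P x) i * z ^ i)" for x
    using binary_form_affine[OF deg, of x z] by (simp add: binary_form_def)
  have "((\<lambda>x. norm (coeff (P x) n) * \<epsilon> ^ n - norm (poly (P x) z))
      \<longlongrightarrow> norm (coeff (P x0) n) * \<epsilon> ^ n - norm (poly (P x0) z)) (nhds x0)"
    unfolding poly_eq by (intro tendsto_intros lim)
  moreover have "0 < norm (coeff (P x0) n) * \<epsilon> ^ n - norm (poly (P x0) z)"
    using lead \<epsilon> root by simp
  ultimately have "\<forall>\<^sub>F x in nhds x0. 0 < norm (coeff (P x) n) * \<epsilon> ^ n - norm (poly (P x) z)"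
    by (rule order_tendstoD)
  then show ?thesis
  proof eventually_elim
    case (elim x)
    then have "coeff (P x) n \<noteq> 0"
      by auto
    then show ?case
      using root_within[OF deg _ \<epsilon>, of x z] elim by auto
  qed
qed

lemma card_roots:
  fixes p :: "complex poly"
  assumes "\<And>a. poly p a = 0 \<Longrightarrow> poly (pderiv p) a \<noteq> 0"
  shows "card {z. poly p z = 0} = degree p"
proof -
  have "p \<noteq> 0"
    using assms[of 0] by auto
  have "rsquarefree p"
    using assms by (auto simp: rsquarefree_roots)
  then have "degree p = degree (smult (lead_coeff p) (\<Prod>z|poly p z = 0. [:- z, 1:]))"
    by (simp only: complex_poly_decompose_rsquarefree)
  also have "\<dots> = (\<Sum>z|poly p z = 0. degree [:- z, 1:])"
    using \<open>p \<noteq> 0\<close> by (simp add: degree_prod_eq_sum_degree)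
  finally show ?thesis
    by simp
qed

text \<open>
  The pigeonhole argument that turns persistence of roots into a bijection: when as many disjoint
  cells are hit as there are points, each cell contains exactly one point and none lies outside.
\<close>

lemma one_point_per_cell:
  assumes fin: "finite F" "finite Q" and card: "card F = card Q"
    and hit: "\<And>z. z \<in> Q \<Longrightarrow> F \<inter> D z \<noteq> {}"
    and disj: "\<And>z z'. z \<in> Q \<Longrightarrow> z' \<in> Q \<Longrightarrow> z \<noteq> z' \<Longrightarrow> D z \<inter> D z' = {}"
  shows "F \<subseteq> (\<Union>z\<in>Q. D z)" and "z \<in> Q \<Longrightarrow> \<exists>w. F \<inter> D z = {w}"
proof -
  define f where "f z = (SOME w. w \<in> F \<inter> D z)" for z
  have f: "f z \<in> F \<inter> D z" if "z \<in> Q" for z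
    unfolding f_def some_in_eq using hit[OF that] .
  have "inj_on f Q"
    using f disj by (intro inj_onI) (metis IntD2 disjoint_iff)
  then have F: "f ` Q = F"
    using f fin card by (intro card_subset_eq) (auto simp: card_image)
  then show "F \<subseteq> (\<Union>z\<in>Q. D z)"
    using f by blast
  assume z: "z \<in> Q"
  have "w = f z" if "w \<in> F \<inter> D z" for w
  proof -
    from that F obtain z' where "z' \<in> Q" "w = f z'"
      by blast
    then show ?thesis
      using f disj[of z z'] z that by blast
  qed
  then show "\<exists>w. F \<inter> D z = {w}"
    using f[OF z] by blast
qed

lemma finite_set_separated:
  fixes Q :: "'a::metric_space set"
  assumes "finite Q"
  obtains \<epsilon> where "\<epsilon> > 0" "\<And>z z'. z \<in> Q \<Longrightarrow> z' \<in> Q \<Longrightarrow> z \<noteq> z' \<Longrightarrow> ball z \<epsilon> \<inter> ball z' \<epsilon> = {}"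
proof -
  define \<delta> where "\<delta> = Min (insert 1 ((\<lambda>(z, z'). dist z z') ` {(z, z') \<in> Q \<times> Q. z \<noteq> z'}))"
  have fin: "finite ((\<lambda>(z, z'). dist z z') ` {(z, z') \<in> Q \<times> Q. z \<noteq> z'})"
    by (rule finite_imageI, rule finite_subset[of _ "Q \<times> Q"]) (use assms in auto)
  have "\<delta> > 0"
    unfolding \<delta>_def using fin by (subst Min_gr_iff) auto
  then have "\<delta> / 2 > 0"
    by simp
  moreover have "ball z (\<delta> / 2) \<inter> ball z' (\<delta> / 2) = {}" if "z \<in> Q" "z' \<in> Q" "z \<noteq> z'" for z z'
  proof -
    have "dist z z' \<in> (\<lambda>(z, z'). dist z z') ` {(z, z') \<in> Q \<times> Q. z \<noteq> z'}"
      using that by (intro image_eqI[of _ _ "(z, z')"]) auto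
    then have "\<delta> \<le> dist z z'"
      unfolding \<delta>_def using fin by (intro Min_le) auto
    then show ?thesis
      by (intro disjoint_ballI) simp
  qed
  ultimately show thesis
    by (rule that)
qed

section \<open>Weierstrass data with prescribed coefficients\<close>

text \<open>
  The types \<open>9\<close>, \<open>13\<close> and \<open>27\<close> that index coordinates all abbreviate types of the form
  \<open>'a bit1\<close>.
\<close>

lemma inj_on_of_nat_bit1:
  "inj_on (of_nat :: nat \<Rightarrow> 'a::finite bit1) {..<CARD('a bit1)}"
proof (rule inj_onI)
  fix i j :: nat
  assume ij: "i \<in> {..<CARD('a bit1)}" "j \<in> {..<CARD('a bit1)}"
    and eq: "(of_nat i :: 'a bit1) = of_nat j"
  have "Rep_bit1 (of_nat k :: 'a bit1) = int k" if "k \<in> {..<CARD('a bit1)}" for k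
  proof -
    have "int k mod int CARD('a bit1) = int k" "int k \<in> {0..<int CARD('a bit1)}"
      using that by auto
    then show ?thesis
      by (simp add: bit1.of_nat_eq Abs_bit1'_def Abs_bit1_inverse)
  qed
  then show "i = j"
    using ij eq by (metis of_nat_eq_iff)
qed

definition vec_of :: "(nat \<Rightarrow> complex) \<Rightarrow> complex ^ ('a::finite bit1)" where
  "vec_of c = (\<chi> k. c (inv_into {..<CARD('a bit1)} of_nat k))"

lemma vec_of_nth:
  "i < CARD('a::finite bit1) \<Longrightarrow> (vec_of c :: complex ^ ('a bit1)) $ of_nat i = c i"
  unfolding vec_of_def using inj_on_of_nat_bit1[where 'a = 'a] by (simp add: inv_into_f_f)

definition weierstrass_of :: "complex poly \<Rightarrow> complex poly \<Rightarrow> weierstrass" where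
  "weierstrass_of P Q = (vec_of (coeff P), vec_of (coeff Q))"

lemma poly_A_weierstrass_of:
  assumes "degree P \<le> 8"
  shows "poly_A (weierstrass_of P Q) = P"
proof -
  have "poly_A (weierstrass_of P Q) = form_poly 8 (coeff P)"
    unfolding poly_A_def weierstrass_of_def by (intro form_poly_cong) (simp add: vec_of_nth)
  then show ?thesis
    by (simp add: form_poly_coeff assms)
qed

lemma poly_B_weierstrass_of:
  assumes "degree Q \<le> 12"
  shows "poly_B (weierstrass_of P Q) = Q"
proof -
  have "poly_B (weierstrass_of P Q) = form_poly 12 (coeff Q)"
    unfolding poly_B_def weierstrass_of_def by (intro form_poly_cong) (simp add: vec_of_nth)
  then show ?thesis
    by (simp add: form_poly_coeff assms)
qed

lemma weierstrass_of_poly: "weierstrass_of (poly_A E) (poly_B E) = E"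
proof -
  have surj: "\<exists>i<CARD('a bit1). k = of_nat i" for k :: "'a::finite bit1"
  proof -
    have "of_nat ` {..<CARD('a bit1)} = (UNIV :: 'a bit1 set)"
      by (intro card_subset_eq) (use card_image[OF inj_on_of_nat_bit1[where 'a = 'a]] in auto)
    then show ?thesis
      by (metis UNIV_I image_iff lessThan_iff)
  qed
  have "fst (weierstrass_of (poly_A E) (poly_B E)) $ k = fst E $ k" for k
  proof -
    obtain i where "i < CARD(9)" "k = of_nat i"
      using surj by blast
    then show ?thesis
      unfolding weierstrass_of_def poly_A_def by (simp add: vec_of_nth coeff_form_poly)
  qed
  moreover have "snd (weierstrass_of (poly_A E) (poly_B E)) $ k = snd E $ k" for k
  proof -
    obtain i where "i < CARD(13)" "k = of_nat i"
      using surj by blast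
    then show ?thesis
      unfolding weierstrass_of_def poly_B_def by (simp add: vec_of_nth coeff_form_poly)
  qed
  ultimately show ?thesis
    by (intro prod_eqI) (simp_all add: Finite_Cartesian_Product.vec_eq_iff)
qed

section \<open>The locus of 24 distinct affine roots\<close>

lemma resultant_pderiv_eq_0_iff:
  fixes p :: "complex poly"
  assumes "degree p \<le> Suc n" "coeff p (Suc n) \<noteq> 0"
  shows "resultant_sub (Suc n) n p (pderiv p) = 0 \<longleftrightarrow> (\<exists>a. poly p a = 0 \<and> poly (pderiv p) a = 0)"
proof -
  have deg: "degree p = Suc n"
    using assms by (intro antisym le_degree)
  then have deg': "degree (pderiv p) = n" "p \<noteq> 0"
    by (auto simp: degree_pderiv)
  then have gcd: "gcd p (pderiv p) \<noteq> 0"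
    by simp
  have "resultant_sub (Suc n) n p (pderiv p) = 0 \<longleftrightarrow> degree (gcd p (pderiv p)) \<noteq> 0"
    using resultant_0_gcd[of p "pderiv p"] deg deg' by (simp add: resultant_sub)
  also have "\<dots> \<longleftrightarrow> (\<exists>a. poly (gcd p (pderiv p)) a = 0)"
  proof
    assume "degree (gcd p (pderiv p)) \<noteq> 0"
    then show "\<exists>a. poly (gcd p (pderiv p)) a = 0"
      by (intro alg_closed_imp_poly_has_root) simp
  next
    assume "\<exists>a. poly (gcd p (pderiv p)) a = 0"
    then obtain a where "[:- a, 1:] dvd gcd p (pderiv p)"
      by (auto simp: poly_eq_0_iff_dvd)
    then show "degree (gcd p (pderiv p)) \<noteq> 0"
      using dvd_imp_degree_le[OF _ gcd] by fastforce
  qed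
  also have "\<dots> \<longleftrightarrow> (\<exists>a. poly p a = 0 \<and> poly (pderiv p) a = 0)"
    by (simp add: poly_eq_0_iff_dvd)
  finally show ?thesis .
qed

text \<open>
  The first condition says that infinity is not a zero of the discriminant, the second that the 24
  affine zeros are distinct.
\<close>

definition simple_locus :: "weierstrass set" where
  "simple_locus = {E. coeff (disc_poly E) 24 \<noteq> 0 \<and>
     resultant_sub 24 23 (disc_poly E) (pderiv (disc_poly E)) \<noteq> 0}"

lemma zariski_open_simple_locus: "zariski_open simple_locus"
proof -
  define f where "f E = coeff (disc_poly E) 24 *
    resultant_sub 24 23 (disc_poly E) (pderiv (disc_poly E))" for E
  have "(\<lambda>E. coeff (disc_poly E) 24) \<in> polynomial_functions"
    using coeffs_in_disc_poly unfolding poly_fun.coeffs_in_def by blast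
  then have "f \<in> polynomial_functions"
    unfolding f_def
    by (rule poly_fun.mult_mem[OF _ poly_fun.resultant_sub_mem])
      (rule coeffs_in_disc_poly poly_fun.coeffs_in_pderiv)+
  moreover have "simple_locus = - {E. \<forall>g\<in>{f}. g E = 0}"
    by (auto simp: simple_locus_def f_def)
  ultimately show ?thesis
    unfolding zariski_open_def by blast
qed

lemma simple_locusD:
  assumes "E \<in> simple_locus"
  shows "coeff (disc_poly E) 24 \<noteq> 0" "card {z. poly (disc_poly E) z = 0} = 24"
    "finite {z. poly (disc_poly E) z = 0}"
proof -
  show lead: "coeff (disc_poly E) 24 \<noteq> 0"
    using assms by (simp add: simple_locus_def)
  then have "degree (disc_poly E) = 24" "disc_poly E \<noteq> 0"
    using degree_disc_poly[of E] le_degree by (auto intro: antisym)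
  moreover have "\<not> (\<exists>a. poly (disc_poly E) a = 0 \<and> poly (pderiv (disc_poly E)) a = 0)"
    using assms resultant_pderiv_eq_0_iff[of "disc_poly E" 23] degree_disc_poly[of E]
    by (simp add: simple_locus_def)
  ultimately show "card {z. poly (disc_poly E) z = 0} = 24" "finite {z. poly (disc_poly E) z = 0}"
    using card_roots[of "disc_poly E"] by (auto simp: poly_roots_finite)
qed

text \<open>
  For \<open>A = -3\<close> and \<open>B = 2 z^12\<close> the discriminant is \<open>108 (z^24 - 1)\<close>.
\<close>

lemma simple_locus_nonempty: "simple_locus \<noteq> {}"
proof -
  define E where "E = weierstrass_of [:-3:] (monom 2 12)"
  have p: "disc_poly E = monom 108 24 - [:108:]"
    by (simp add: E_def poly_A_weierstrass_of poly_B_weierstrass_of degree_monom_eq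
      discriminant_poly_def power2_eq_square power3_eq_cube mult_monom smult_monom)
  have lead: "coeff (disc_poly E) 24 = 108"
    unfolding p by (simp add: coeff_pCons)
  have "\<not> (poly (disc_poly E) a = 0 \<and> poly (pderiv (disc_poly E)) a = 0)" for a
    unfolding p by (auto simp: poly_monom pderiv_diff pderiv_monom pderiv_pCons)
  then have "resultant_sub (Suc 23) 23 (disc_poly E) (pderiv (disc_poly E)) \<noteq> 0"
    using lead degree_disc_poly[of E] by (subst resultant_pderiv_eq_0_iff) auto
  then have "E \<in> simple_locus"
    using lead by (simp add: simple_locus_def)
  then show ?thesis
    by blast
qed

lemma fibre_Z: "fibre Z fst E = Pair E ` {q. discriminant_vanishes E q}"
  by (auto simp: fibre_def Z_def)

lemma fibre_Z_affine:
  assumes "coeff (disc_poly E) 24 \<noteq> 0"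
  shows "fibre Z fst E = (\<lambda>z. (E, affine_point z)) ` {z. poly (disc_poly E) z = 0}"
proof -
  have "{q. discriminant_vanishes E q} = affine_point ` {z. poly (disc_poly E) z = 0}"
  proof
    show "{q. discriminant_vanishes E q} \<subseteq> affine_point ` {z. poly (disc_poly E) z = 0}"
      by (auto elim: vanishes_imp_affine[OF assms])
  qed (auto simp: vanishes_affine_point)
  then show ?thesis
    by (simp add: fibre_Z image_image)
qed

lemma cont_coeffs_in_disc_poly: "cont_fun.coeffs_in disc_poly"
  using coeffs_in_disc_poly polynomial_functions_continuous
  by (simp add: cont_fun.coeffs_in_def poly_fun.coeffs_in_def)

text \<open>
  Around the 24 roots for \<open>E0\<close> there are disjoint discs, each of which still contains a root for
  \<open>E\<close> near \<open>E0\<close>, hence exactly one. The roots in one disc form one sheet; the inverse of the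
  projection on it is continuous because roots persist in arbitrarily small discs.
\<close>

lemma unbranched_over_simple_locus: "unbranched_over 24 Z fst simple_locus"
  unfolding unbranched_over_def
proof (intro conjI ballI)
  fix E assume E: "E \<in> simple_locus"
  show "finite (fibre Z fst E)" "card (fibre Z fst E) = 24"
    using simple_locusD[OF E] by (auto simp: fibre_Z_affine card_image inj_on_def)
next
  let ?C = "Z \<inter> fst -` simple_locus"
  show "covering_space ?C fst simple_locus"
  proof
    show "continuous_on ?C fst"
      by (intro continuous_intros)
    have "fibre Z fst E \<noteq> {}" if "E \<in> simple_locus" for E
    proof -
      have "{z. poly (disc_poly E) z = 0} \<noteq> {}"
        using simple_locusD(2)[OF that] by (metis card.empty zero_neq_numeral)
      then show ?thesis
        using simple_locusD(1)[OF that] by (simp add: fibre_Z_affine)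
    qed
    then show "fst ` ?C = simple_locus"
      by (force simp: fibre_def)
  next
    fix E0 assume E0: "E0 \<in> simple_locus"
    define rts where "rts E = {z. poly (disc_poly E) z = 0}" for E
    have rts: "finite (rts E)" "card (rts E) = 24" if "E \<in> simple_locus" for E
      using simple_locusD[OF that] by (auto simp: rts_def)
    obtain \<epsilon> where \<epsilon>: "\<epsilon> > 0"
      and disj: "\<And>z z'. z \<in> rts E0 \<Longrightarrow> z' \<in> rts E0 \<Longrightarrow> z \<noteq> z' \<Longrightarrow> ball z \<epsilon> \<inter> ball z' \<epsilon> = {}"
      using finite_set_separated[OF rts(1)[OF E0]] by metis
    (* Used at E0 with the radius of the discs, and again at nearby E1 for the continuity of the roots. *)
    have near: "\<forall>\<^sub>F E in nhds E1. rts E \<inter> ball z \<delta> \<noteq> {}"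
      if "E1 \<in> simple_locus" "z \<in> rts E1" "\<delta> > 0" for E1 z \<delta>
    proof -
      have "\<forall>\<^sub>F E in nhds E1. \<exists>w. poly (disc_poly E) w = 0 \<and> dist w z < \<delta>"
        using simple_locusD(1)[OF that(1)] that(2,3)
        by (intro nearby_root[OF cont_coeffs_in_disc_poly degree_disc_poly]) (auto simp: rts_def)
      then show ?thesis
        by eventually_elim (auto simp: rts_def dist_commute)
    qed
    have "\<forall>\<^sub>F E in nhds E0. \<forall>z\<in>rts E0. rts E \<inter> ball z \<epsilon> \<noteq> {}"
      by (intro eventually_ball_finite rts(1) E0 ballI near \<epsilon>)
    then obtain S where S: "open S" "E0 \<in> S" "\<And>E z. E \<in> S \<Longrightarrow> z \<in> rts E0 \<Longrightarrow> rts E \<inter> ball z \<epsilon> \<noteq> {}"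
      unfolding eventually_nhds by blast
    define T where "T = S \<inter> simple_locus"
    have cells: "rts E \<subseteq> (\<Union>z\<in>rts E0. ball z \<epsilon>)" "\<And>z. z \<in> rts E0 \<Longrightarrow> \<exists>w. rts E \<inter> ball z \<epsilon> = {w}"
      if "E \<in> T" for E
    proof -
      have E: "E \<in> S" "E \<in> simple_locus"
        using that by (simp_all add: T_def)
      have "card (rts E) = card (rts E0)"
        by (simp add: rts(2) E(2) E0)
      note * = one_point_per_cell[of "rts E" "rts E0" "\<lambda>z. ball z \<epsilon>",
          OF rts(1)[OF E(2)] rts(1)[OF E0] this S(3)[OF E(1)] disj]
      show "rts E \<subseteq> (\<Union>z\<in>rts E0. ball z \<epsilon>)"
        by (rule *(1))
      show "\<exists>w. rts E \<inter> ball z \<epsilon> = {w}" if "z \<in> rts E0" for z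
        by (rule *(2)[OF _ _ _ _ that])
    qed
    (* The root in the disc around z. *)
    define \<rho> where "\<rho> z E = (THE w. w \<in> rts E \<inter> ball z \<epsilon>)" for z E
    have \<rho>: "rts E \<inter> ball z \<epsilon> = {\<rho> z E}" if "E \<in> T" "z \<in> rts E0" for z E
    proof -
      from cells(2)[OF that] obtain w where "rts E \<inter> ball z \<epsilon> = {w}"
        by blast
      then show ?thesis
        by (simp add: \<rho>_def)
    qed
    have cont_\<rho>: "continuous_on T (\<rho> z)" if z: "z \<in> rts E0" for z
      unfolding continuous_on_def
    proof (intro ballI tendstoI)
      fix E1 and e :: real assume E1: "E1 \<in> T" and e: "e > 0"
      have E1': "E1 \<in> simple_locus" "\<rho> z E1 \<in> rts E1" "dist z (\<rho> z E1) < \<epsilon>"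
        using \<rho>[OF E1 z] E1 by (auto simp: T_def)
      (* Small enough for the disc around the root of E1 to stay inside the disc around z. *)
      define \<delta> where "\<delta> = min e (\<epsilon> - dist z (\<rho> z E1))"
      have "\<forall>\<^sub>F E in nhds E1. rts E \<inter> ball (\<rho> z E1) \<delta> \<noteq> {}"
        using E1' e by (intro near) (auto simp: \<delta>_def)
      then have "\<forall>\<^sub>F E in at E1 within T. rts E \<inter> ball (\<rho> z E1) \<delta> \<noteq> {}"
        unfolding eventually_at_filter by (rule eventually_mono) blast
      moreover have "\<forall>\<^sub>F E in at E1 within T. E \<in> T"
        by (simp add: eventually_at_filter)
      ultimately show "\<forall>\<^sub>F E in at E1 within T. dist (\<rho> z E) (\<rho> z E1) < e"
      proof eventually_elim
        case (elim E)
        then obtain w where w: "w \<in> rts E" "dist (\<rho> z E1) w < \<delta>"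
          by auto
        then have "dist z w < \<epsilon>"
          using dist_triangle[of z w "\<rho> z E1"] by (simp add: \<delta>_def)
        then have "w \<in> rts E \<inter> ball z \<epsilon>"
          using w(1) by simp
        then have "w = \<rho> z E"
          unfolding \<rho>[OF elim(2) z] by simp
        then show ?case
          using w by (simp add: \<delta>_def dist_commute)
      qed
    qed
    define V where "V z = ?C \<inter> (S \<times> affine_point ` ball z \<epsilon>)" for z
    have in_V: "(E, q) \<in> V z \<longleftrightarrow> E \<in> T \<and> (\<exists>w \<in> rts E \<inter> ball z \<epsilon>. q = affine_point w)" for E q z
      by (auto simp: V_def T_def Z_def rts_def vanishes_affine_point)
    show "\<exists>T. E0 \<in> T \<and> openin (top_of_set simple_locus) T \<and>
      (\<exists>\<V>. \<Union>\<V> = ?C \<inter> fst -` T \<and> (\<forall>V\<in>\<V>. openin (top_of_set ?C) V) \<and> pairwise disjnt \<V> \<and>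
        (\<forall>V\<in>\<V>. \<exists>q. homeomorphism V T fst q))"
    proof (intro exI[of _ T] conjI exI[of _ "V ` rts E0"] ballI)
      show "E0 \<in> T" "openin (top_of_set simple_locus) T"
        using S E0 by (auto simp: T_def openin_open)
      show "\<Union> (V ` rts E0) = ?C \<inter> fst -` T"
      proof
        show "\<Union> (V ` rts E0) \<subseteq> ?C \<inter> fst -` T"
          by (auto simp: V_def T_def)
        show "?C \<inter> fst -` T \<subseteq> \<Union> (V ` rts E0)"
        proof
          fix y assume "y \<in> ?C \<inter> fst -` T"
          then obtain E q where y: "y = (E, q)" "E \<in> T" "discriminant_vanishes E q"
            by (cases y) (auto simp: Z_def)
          then obtain w where w: "q = affine_point w" "w \<in> rts E"
            using vanishes_imp_affine[of E q] simple_locusD(1)[of E] by (auto simp: T_def rts_def)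
          then obtain z where "z \<in> rts E0" "w \<in> ball z \<epsilon>"
            using cells(1)[OF y(2)] by blast
          then show "y \<in> \<Union> (V ` rts E0)"
            using y(1,2) w in_V[of E q z] by blast
        qed
      qed
      show "pairwise disjnt (V ` rts E0)"
      proof (rule pairwiseI)
        fix V1 V2 assume "V1 \<in> V ` rts E0" "V2 \<in> V ` rts E0" "V1 \<noteq> V2"
        then obtain z1 z2 where z: "z1 \<in> rts E0" "z2 \<in> rts E0" "z1 \<noteq> z2" "V1 = V z1" "V2 = V z2"
          by blast
        show "disjnt V1 V2"
          unfolding disjnt_iff z
        proof (intro allI notI)
          fix y assume "y \<in> V z1 \<and> y \<in> V z2"
          then obtain w1 w2 where "w1 \<in> ball z1 \<epsilon>" "w2 \<in> ball z2 \<epsilon>" "affine_point w1 = affine_point w2"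
            using in_V[of "fst y" "snd y"] by auto
          then show False
            using disj[OF z(1-3)] by auto
        qed
      qed
    next
      fix W assume "W \<in> V ` rts E0"
      then obtain z where z: "z \<in> rts E0" "W = V z"
        by blast
      show "openin (top_of_set ?C) W"
        unfolding z V_def using S(1) by (intro openin_open_Int open_Times open_affine_image) auto
      have "homeomorphism (V z) T fst (\<lambda>E. (E, affine_point (\<rho> z E)))"
      proof (rule homeomorphismI)
        show "continuous_on (V z) fst"
          by (intro continuous_intros)
        show "continuous_on T (\<lambda>E. (E, affine_point (\<rho> z E)))"
          by (intro continuous_intros continuous_on_compose2[OF continuous_on_affine_point cont_\<rho>[OF z(1)]]) auto
        show "fst ` V z \<subseteq> T" "(\<lambda>E. (E, affine_point (\<rho> z E))) ` T \<subseteq> V z"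
          using in_V \<rho>[OF _ z(1)] by auto
        show "(fst y, affine_point (\<rho> z (fst y))) = y" if "y \<in> V z" for y
        proof -
          obtain E q where y: "y = (E, q)"
            by (cases y)
          with that in_V obtain w where w: "E \<in> T" "w \<in> rts E \<inter> ball z \<epsilon>" "q = affine_point w"
            by blast
          then have "w = \<rho> z E"
            unfolding \<rho>[OF w(1) z(1)] by blast
          then show ?thesis
            using y w(3) by (simp only: fst_conv)
        qed
      qed auto
      then show "\<exists>q. homeomorphism W T fst q"
        using z by blast
    qed
  qed
qed

section \<open>Sets that are cofinite on complex lines\<close>

definition complex_line :: "complex ^ 'n \<Rightarrow> complex ^ 'n \<Rightarrow> complex \<Rightarrow> complex ^ 'n" where
  "complex_line a b z = (\<chi> i. a $ i + z * (b $ i - a $ i))"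

lemma complex_line_0 [simp]: "complex_line a b 0 = a"
  and complex_line_1 [simp]: "complex_line a b 1 = b"
  by (simp_all add: complex_line_def)

lemma complex_line_nth: "complex_line a b z $ i = a $ i + z * (b $ i - a $ i)"
  by (simp add: complex_line_def)

lemma continuous_on_complex_line: "continuous_on D (complex_line a b)"
  unfolding complex_line_def by (intro continuous_intros)

lemma complex_line_convex_combination:
  assumes "u + v = (1::real)"
  shows "complex_line a b (u *\<^sub>R z + v *\<^sub>R w) = u *\<^sub>R complex_line a b z + v *\<^sub>R complex_line a b w"
proof -
  have v: "of_real v = (1 - of_real u :: complex)"
    using assms by (simp add: eq_diff_eq add.commute flip: of_real_add)
  have "c + (of_real u * z + of_real v * w) * d
    = of_real u * (c + z * d) + of_real v * (c + w * d)" for c d :: complex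
    by (simp add: v algebra_simps)
  then show ?thesis
    unfolding Finite_Cartesian_Product.vec_eq_iff vector_add_component vector_scaleR_component complex_line_nth
    unfolding scaleR_conv_of_real by blast
qed

text \<open>
  Preimages of Zariski open sets under polynomial maps have this property, since a polynomial
  in one variable that does not vanish identically has finitely many zeros. It suffices for
  connectedness and density arguments, without any dimension theory.
\<close>

definition cofinite_on_lines :: "(complex ^ 'n) set \<Rightarrow> bool" where
  "cofinite_on_lines S \<longleftrightarrow> (\<forall>a\<in>S. \<forall>b. finite {z. complex_line a b z \<notin> S})"

lemma open_complex_line_vimage:
  assumes "open W"
  shows "open {z. complex_line a b z \<in> W}"
  using open_vimage[OF assms continuous_on_complex_line[of UNIV a b]] by (simp add: vimage_def)

text \<open>
  On the complex line through two points, a convex open set cuts out a convex open subset of the plane,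
  which stays path connected when finitely many points are removed.
\<close>

lemma path_connected_convex_Int_cofinite:
  assumes W: "open W" "convex W" and S: "cofinite_on_lines S"
  shows "path_connected (W \<inter> S)"
  unfolding path_connected_component
proof (intro ballI)
  fix a b assume a: "a \<in> W \<inter> S" and b: "b \<in> W \<inter> S"
  define D where "D = {z. complex_line a b z \<in> W}"
  define N where "N = {z. complex_line a b z \<notin> S}"
  have "convex D"
    using W(2) unfolding convex_def D_def by (auto simp: complex_line_convex_combination)
  moreover have "open D"
    unfolding D_def by (rule open_complex_line_vimage[OF W(1)])
  moreover have "finite N"
    using S a unfolding cofinite_on_lines_def N_def by blast
  ultimately have "path_connected (D - N)"
    by (intro path_connected_open_diff_countable convex_connected countable_finite) auto
  then have "path_connected (complex_line a b ` (D - N))"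
    by (rule path_connected_continuous_image[OF continuous_on_complex_line])
  moreover have "0 \<in> D - N" "1 \<in> D - N"
    using a b by (simp_all add: D_def N_def)
  then have "a \<in> complex_line a b ` (D - N)" "b \<in> complex_line a b ` (D - N)"
    by (metis complex_line_0 imageI, metis complex_line_1 imageI)
  ultimately have "path_component (complex_line a b ` (D - N)) a b"
    unfolding path_connected_component by blast
  then show "path_component (W \<inter> S) a b"
    by (rule path_component_of_subset[rotated]) (auto simp: D_def N_def)
qed

lemma open_Int_cofinite_nonempty:
  assumes W: "open W" "a \<in> W" and S: "cofinite_on_lines S" "s \<in> S"
  shows "W \<inter> S \<noteq> {}"
proof -
  have "open {z. complex_line s a z \<in> W}" "1 \<in> {z. complex_line s a z \<in> W}"
    using open_complex_line_vimage[OF W(1)] W(2) by simp_all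
  then have "infinite {z. complex_line s a z \<in> W}"
    using finite_imp_not_open by blast
  moreover have "finite {z. complex_line s a z \<notin> S}"
    using S unfolding cofinite_on_lines_def by blast
  ultimately have "\<not> {z. complex_line s a z \<in> W} \<subseteq> {z. complex_line s a z \<notin> S}"
    using finite_subset by blast
  then show ?thesis
    by blast
qed

interpretation line_fun: function_algebra "range poly :: (complex \<Rightarrow> complex) set"
proof
  show "(\<lambda>_. c) \<in> range poly" for c :: complex
    by (rule image_eqI[of _ _ "[:c:]"]) auto
  show "(\<lambda>x. f x + g x) \<in> range poly" if "f \<in> range poly" "g \<in> range poly" for f g :: "complex \<Rightarrow> complex"
    using that by (auto simp: image_iff fun_eq_iff simp flip: poly_add)
  show "(\<lambda>x. f x * g x) \<in> range poly" if "f \<in> range poly" "g \<in> range poly" for f g :: "complex \<Rightarrow> complex"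
    using that by (auto simp: image_iff fun_eq_iff simp flip: poly_mult)
qed

lemma complex_line_mem: "(\<lambda>z. complex_line a b z $ i) \<in> range poly"
  by (rule image_eqI[of _ _ "[:a $ i, b $ i - a $ i:]"]) (auto simp: complex_line_nth)

lemma finite_zeros:
  fixes g :: "complex \<Rightarrow> complex"
  assumes "g \<in> range poly" "g z0 \<noteq> 0"
  shows "finite {z. g z = 0}"
proof -
  obtain q where q: "g = poly q"
    using assms(1) by blast
  then have "q \<noteq> 0"
    using assms(2) by auto
  then show ?thesis
    unfolding q by (rule poly_roots_finite)
qed

section \<open>Weierstrass data with two marked zeros of the discriminant\<close>

text \<open>
  The 27 parameters are the coordinates of two vectors that represent points of the projective line,
  the 5 coefficients of a quartic form \<open>C\<close>, and the 7 and 11 coefficients of two further forms \<open>P\<close>,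
  \<open>Q\<close> of degrees 6 and 10. With \<open>l\<close> and \<open>m\<close> the linear forms vanishing at the two points, they
  define \<open>A = -3 C^2 + l m P\<close> and \<open>B = 2 C^3 + l m Q\<close>. As \<open>(-3 c^2, 2 c^3)\<close> lies on the cuspidal
  cubic \<open>4 a^3 + 27 b^2 = 0\<close>, the discriminant of \<open>(A, B)\<close> vanishes at both points. The formulas
  make sense for coinciding points as well, where they produce a zero that is at least double.
\<close>

definition mark1 :: "complex ^ 27 \<Rightarrow> complex \<times> complex" where
  "mark1 x = (x $ 0, x $ 1)"

definition mark2 :: "complex ^ 27 \<Rightarrow> complex \<times> complex" where
  "mark2 x = (x $ 2, x $ 3)"

definition cusp_param :: "complex ^ 27 \<Rightarrow> complex poly" where
  "cusp_param x = form_poly 4 (\<lambda>i. x $ of_nat (4 + i))"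

definition cofactor_A :: "complex ^ 27 \<Rightarrow> complex poly" where
  "cofactor_A x = form_poly 6 (\<lambda>i. x $ of_nat (9 + i))"

definition cofactor_B :: "complex ^ 27 \<Rightarrow> complex poly" where
  "cofactor_B x = form_poly 10 (\<lambda>i. x $ of_nat (16 + i))"

definition family_A :: "complex ^ 27 \<Rightarrow> complex poly" where
  "family_A x = smult (-3) (cusp_param x ^ 2) + linear_form (mark1 x) * linear_form (mark2 x) * cofactor_A x"

definition family_B :: "complex ^ 27 \<Rightarrow> complex poly" where
  "family_B x = smult 2 (cusp_param x ^ 3) + linear_form (mark1 x) * linear_form (mark2 x) * cofactor_B x"

definition family :: "complex ^ 27 \<Rightarrow> weierstrass" where
  "family x = weierstrass_of (family_A x) (family_B x)"

lemma degree_params: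
  "degree (cusp_param x) \<le> 4" "degree (cofactor_A x) \<le> 6" "degree (cofactor_B x) \<le> 10"
  by (simp_all add: cusp_param_def cofactor_A_def cofactor_B_def degree_form_poly)

lemma degree_two_linear_forms: "degree (linear_form v * linear_form w) \<le> 2"
  using degree_mult_le[of "linear_form v" "linear_form w"] degree_linear_form[of v] degree_linear_form[of w]
  by linarith

lemma degree_family: "degree (family_A x) \<le> 8" "degree (family_B x) \<le> 12"
proof -
  have L: "degree (linear_form (mark1 x) * linear_form (mark2 x) * cofactor_A x) \<le> 8"
    "degree (linear_form (mark1 x) * linear_form (mark2 x) * cofactor_B x) \<le> 12"
    using order_trans[OF degree_mult_le add_mono[OF degree_two_linear_forms degree_params(2)]]
      order_trans[OF degree_mult_le add_mono[OF degree_two_linear_forms degree_params(3)]] by simp_all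
  have C: "degree (cusp_param x ^ 2) \<le> 8" "degree (cusp_param x ^ 3) \<le> 12"
    using degree_power_le[of "cusp_param x" 2] degree_power_le[of "cusp_param x" 3] degree_params(1)[of x]
    by linarith+
  show "degree (family_A x) \<le> 8" "degree (family_B x) \<le> 12"
    unfolding family_A_def family_B_def
    using degree_add_le[OF order_trans[OF degree_smult_le C(1)] L(1)]
      degree_add_le[OF order_trans[OF degree_smult_le C(2)] L(2)] by blast+
qed

lemma poly_family: "poly_A (family x) = family_A x" "poly_B (family x) = family_B x"
  by (simp_all add: family_def poly_A_weierstrass_of poly_B_weierstrass_of degree_family)

lemma binary_form_two_linear_forms:
  "binary_form 2 (coeff (linear_form v * linear_form w)) u
    = (fst u * snd v - fst v * snd u) * (fst u * snd w - fst w * snd u)"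
  using binary_form_mult[OF degree_linear_form degree_linear_form, of v w u]
  unfolding binary_form_linear_form by (simp add: numeral_2_eq_2)

lemma binary_form_family:
  fixes x u
  defines "l \<equiv> (fst u * snd (mark1 x) - fst (mark1 x) * snd u) * (fst u * snd (mark2 x) - fst (mark2 x) * snd u)"
    and "c \<equiv> binary_form 4 (coeff (cusp_param x)) u"
  shows "binary_form 8 (coeff (family_A x)) u = - 3 * c ^ 2 + l * binary_form 6 (coeff (cofactor_A x)) u"
    and "binary_form 12 (coeff (family_B x)) u = 2 * c ^ 3 + l * binary_form 10 (coeff (cofactor_B x)) u"
  using binary_form_power[OF degree_params(1), of 2 x u] binary_form_power[OF degree_params(1), of 3 x u]
    binary_form_mult[OF degree_two_linear_forms degree_params(2), of "mark1 x" "mark2 x" x u]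
    binary_form_mult[OF degree_two_linear_forms degree_params(3), of "mark1 x" "mark2 x" x u]
  unfolding family_A_def family_B_def binary_form_add binary_form_smult l_def c_def
  by (simp_all add: binary_form_two_linear_forms)

lemma discriminant_family_marks:
  "discriminant (family x) (mark1 x) = 0" "discriminant (family x) (mark2 x) = 0"
  unfolding discriminant_eq poly_family binary_form_family by (simp_all add: power_mult_distrib flip: power_mult)

lemma of_nat_27_eq_iff:
  assumes "i < 27" "j < 27"
  shows "(of_nat i :: 27) = of_nat j \<longleftrightarrow> i = j"
proof -
  have "CARD(27) = 27"
    by simp
  then show ?thesis
    using inj_on_of_nat_bit1[where 'a = 13] assms inj_on_eq_iff by fastforce
qed

text \<open>
  The involution that exchanges the two marked points. It does not change \<open>(A, B)\<close>, so a path from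
  \<open>x\<close> to \<open>swap_marks x\<close> becomes a loop of Weierstrass data along which the marked zeros trade places.
\<close>

definition swap_marks :: "complex ^ 27 \<Rightarrow> complex ^ 27" where
  "swap_marks x = (\<chi> k. if k = 0 then x $ 2 else if k = 1 then x $ 3
     else if k = 2 then x $ 0 else if k = 3 then x $ 1 else x $ k)"

lemma mark_swap_marks [simp]: "mark1 (swap_marks x) = mark2 x" "mark2 (swap_marks x) = mark1 x"
  by (simp_all add: mark1_def mark2_def swap_marks_def)

lemma swap_marks_nth:
  assumes "4 \<le> i" "i < 27"
  shows "swap_marks x $ of_nat i = x $ of_nat i"
  using assms of_nat_27_eq_iff[of i 0] of_nat_27_eq_iff[of i 1] of_nat_27_eq_iff[of i 2] of_nat_27_eq_iff[of i 3]
  by (simp add: swap_marks_def)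

lemma family_swap_marks: "family (swap_marks x) = family x"
proof -
  have "cusp_param (swap_marks x) = cusp_param x" "cofactor_A (swap_marks x) = cofactor_A x"
    "cofactor_B (swap_marks x) = cofactor_B x"
    unfolding cusp_param_def cofactor_A_def cofactor_B_def
    by (intro form_poly_cong swap_marks_nth; simp)+
  then show ?thesis
    by (simp add: family_def family_A_def family_B_def mult.commute)
qed

lemma continuous_on_swap_marks: "continuous_on D swap_marks"
  unfolding swap_marks_def
proof (intro continuous_on_vec_lambda)
  fix k :: 27
  show "continuous_on D (\<lambda>x :: complex ^ 27. if k = 0 then x $ 2 else if k = 1 then x $ 3
     else if k = 2 then x $ 0 else if k = 3 then x $ 1 else x $ k)"
    by (cases "k = 0"; cases "k = 1"; cases "k = 2"; cases "k = 3") (simp_all add: continuous_intros)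
qed

lemma params_exist:
  assumes deg: "degree C \<le> 4" "degree P \<le> 6" "degree Q \<le> 10"
  obtains x where "mark1 x = v" "mark2 x = w" "cusp_param x = C" "cofactor_A x = P" "cofactor_B x = Q"
proof -
  define c where "c i = (if i = 0 then fst v else if i = 1 then snd v else if i = 2 then fst w
    else if i = 3 then snd w else if i < 9 then coeff C (i - 4) else if i < 16 then coeff P (i - 9)
    else coeff Q (i - 16))" for i :: nat
  define x :: "complex ^ 27" where "x = vec_of c"
  have x: "x $ of_nat i = c i" if "i < 27" for i
    unfolding x_def by (rule vec_of_nth) (use that in simp)
  have "mark1 x = v" "mark2 x = w"
    using x[of 0] x[of 1] x[of 2] x[of 3] by (simp_all add: mark1_def mark2_def c_def)
  moreover have "cusp_param x = form_poly 4 (coeff C)"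
    unfolding cusp_param_def by (rule form_poly_cong, subst x) (auto simp: c_def)
  moreover have "cofactor_A x = form_poly 6 (coeff P)"
    unfolding cofactor_A_def by (rule form_poly_cong, subst x) (auto simp: c_def)
  moreover have "cofactor_B x = form_poly 10 (coeff Q)"
    unfolding cofactor_B_def by (rule form_poly_cong, subst x) (auto simp: c_def)
  ultimately show thesis
    using that deg by (simp add: form_poly_coeff)
qed

lemma cuspidal_cubic_param:
  fixes a b :: complex
  assumes "4 * a ^ 3 + 27 * b ^ 2 = 0"
  obtains c where "a = - 3 * c ^ 2" "b = 2 * c ^ 3"
proof (cases "a = 0")
  case True
  then show thesis
    using assms that[of 0] by simp
next
  case False
  (* The quotient of \<open>b = 2 c^3\<close> by \<open>a = - 3 c^2\<close> is \<open>- 2 c / 3\<close>. *)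
  define c where "c = - 3 * b / (2 * a)"
  have ac: "2 * a * c = - 3 * b"
    using False by (simp add: c_def)
  have "4 * a ^ 2 * (3 * c ^ 2) = 3 * (2 * a * c) ^ 2"
    by (simp add: power_mult_distrib)
  also have "\<dots> = 27 * b ^ 2"
    unfolding ac by (simp add: power_mult_distrib)
  also have "\<dots> = - (4 * a ^ 3)"
    using assms by (simp add: eq_neg_iff_add_eq_0 add.commute)
  also have "\<dots> = 4 * a ^ 2 * (- a)"
    by (simp add: power2_eq_square power3_eq_cube)
  finally have "4 * a ^ 2 * (3 * c ^ 2) = 4 * a ^ 2 * (- a)" .
  moreover have "4 * a ^ 2 \<noteq> 0"
    using False by simp
  ultimately have c2: "3 * c ^ 2 = - a"
    unfolding mult_cancel_left by blast
  have "3 * (2 * c ^ 3) = 2 * c * (3 * c ^ 2)"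
    by (simp add: power2_eq_square power3_eq_cube)
  also have "\<dots> = - (2 * a * c)"
    unfolding c2 by simp
  also have "\<dots> = 3 * b"
    unfolding ac by simp
  finally have "b = 2 * c ^ 3"
    by simp
  moreover have "a = - 3 * c ^ 2"
    using arg_cong[OF c2, of uminus] by simp
  ultimately show thesis
    by (intro that)
qed

text \<open>
  The parameters \<open>c1\<close>, \<open>c2\<close> of the two points of the cuspidal cubic are interpolated by a quartic
  form \<open>C\<close>; then \<open>A + 3 C^2\<close> and \<open>B - 2 C^3\<close> vanish at both points, so \<open>l m\<close> divides them.
\<close>

lemma family_surj:
  assumes v: "v \<noteq> 0" "discriminant E v = 0" and w: "w \<noteq> 0" "discriminant E w = 0"
    and cross: "fst v * snd w \<noteq> snd v * fst w"
  obtains x where "family x = E" "mark1 x = v" "mark2 x = w"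
proof -
  define d where "d = fst v * snd w - snd v * fst w"
  have "d \<noteq> 0"
    using cross by (simp add: d_def)
  obtain c1 where c1: "binary_form 8 (coeff (poly_A E)) v = - 3 * c1 ^ 2"
    "binary_form 12 (coeff (poly_B E)) v = 2 * c1 ^ 3"
    using cuspidal_cubic_param v(2) unfolding discriminant_eq by metis
  obtain c2 where c2: "binary_form 8 (coeff (poly_A E)) w = - 3 * c2 ^ 2"
    "binary_form 12 (coeff (poly_B E)) w = 2 * c2 ^ 3"
    using cuspidal_cubic_param w(2) unfolding discriminant_eq by metis
  (* Lagrange interpolation: the power of a linear form vanishes at one point and equals \<open>d ^ 4\<close> at the other. *)
  define C where "C = smult (c1 / d ^ 4) (linear_form w ^ 4) + smult (c2 / d ^ 4) (linear_form v ^ 4)"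
  have "degree (linear_form u ^ 4) \<le> 4" for u
    using degree_power_le[of "linear_form u" 4] degree_linear_form[of u] by linarith
  then have C: "degree C \<le> 4"
    unfolding C_def by (intro degree_add_le) (auto intro: order_trans[OF degree_smult_le])
  have bf_C: "binary_form 4 (coeff C) u = c1 / d ^ 4 * (fst u * snd w - fst w * snd u) ^ 4
      + c2 / d ^ 4 * (fst u * snd v - fst v * snd u) ^ 4" for u
    using binary_form_power[OF degree_linear_form, of 4 v u] binary_form_power[OF degree_linear_form, of 4 w u]
    unfolding binary_form_linear_form C_def by (simp add: binary_form_add binary_form_smult)
  have "fst w * snd v - fst v * snd w = - d"
    by (simp add: d_def mult.commute)
  moreover have "fst v * snd w - fst w * snd v = d"
    by (simp add: d_def mult.commute)
  ultimately have C_vw: "binary_form 4 (coeff C) v = c1" "binary_form 4 (coeff C) w = c2"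
    using \<open>d \<noteq> 0\<close> by (simp_all add: bf_C mult.commute)
  have powers: "degree (C ^ 2) \<le> 8" "degree (C ^ 3) \<le> 12"
    using degree_power_le[of C 2] degree_power_le[of C 3] C by linarith+
  have bf_powers: "binary_form 8 (coeff (C ^ 2)) u = binary_form 4 (coeff C) u ^ 2"
    "binary_form 12 (coeff (C ^ 3)) u = binary_form 4 (coeff C) u ^ 3" for u
    using binary_form_power[OF C, of 2 u] binary_form_power[OF C, of 3 u] by simp_all
  obtain P where P: "degree P \<le> 6" "poly_A E + smult 3 (C ^ 2) = linear_form v * linear_form w * P"
  proof (rule two_linear_forms_dvd[of "poly_A E + smult 3 (C ^ 2)" 6 v w])
    show "degree (poly_A E + smult 3 (C ^ 2)) \<le> Suc (Suc 6)"
      using degree_poly_A[of E] powers by (intro degree_add_le) (auto intro: order_trans[OF degree_smult_le])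
    show "binary_form (Suc (Suc 6)) (coeff (poly_A E + smult 3 (C ^ 2))) v = 0"
      "binary_form (Suc (Suc 6)) (coeff (poly_A E + smult 3 (C ^ 2))) w = 0"
      using c1 c2 C_vw bf_powers by (simp_all add: binary_form_add binary_form_smult)
  qed (use v w cross in auto)
  obtain Q where Q: "degree Q \<le> 10" "poly_B E + smult (-2) (C ^ 3) = linear_form v * linear_form w * Q"
  proof (rule two_linear_forms_dvd[of "poly_B E + smult (-2) (C ^ 3)" 10 v w])
    show "degree (poly_B E + smult (-2) (C ^ 3)) \<le> Suc (Suc 10)"
      using degree_poly_B[of E] powers by (intro degree_add_le) (auto intro: order_trans[OF degree_smult_le])
    show "binary_form (Suc (Suc 10)) (coeff (poly_B E + smult (-2) (C ^ 3))) v = 0"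
      "binary_form (Suc (Suc 10)) (coeff (poly_B E + smult (-2) (C ^ 3))) w = 0"
      using c1 c2 C_vw bf_powers
      by (simp_all only: binary_form_add binary_form_smult Suc_numeral semiring_norm) simp_all
  qed (use v w cross in auto)
  obtain x where x: "mark1 x = v" "mark2 x = w" "cusp_param x = C" "cofactor_A x = P" "cofactor_B x = Q"
    using params_exist[OF C P(1) Q(1)] by metis
  have "family_A x = poly_A E" "family_B x = poly_B E"
    unfolding family_A_def family_B_def x P(2)[symmetric] Q(2)[symmetric] by simp_all
  then have "family x = E"
    by (simp add: family_def weierstrass_of_poly)
  then show thesis
    using that x by blast
qed

context function_algebra
begin

lemma coeffs_in_family:
  fixes \<psi> :: "'x \<Rightarrow> complex ^ 27"
  assumes \<psi>: "\<And>k. (\<lambda>x. \<psi> x $ k) \<in> R"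
  shows "coeffs_in (\<lambda>x. family_A (\<psi> x))" "coeffs_in (\<lambda>x. family_B (\<psi> x))"
  unfolding family_A_def family_B_def mark1_def mark2_def cusp_param_def cofactor_A_def cofactor_B_def
  by (intro coeffs_in_add coeffs_in_mult coeffs_in_smult coeffs_in_power coeffs_in_linear_form
    coeffs_in_form_poly \<psi>)+

lemma family_mem:
  fixes \<psi> :: "'x \<Rightarrow> complex ^ 27"
  assumes "\<And>k. (\<lambda>x. \<psi> x $ k) \<in> R"
  shows "(\<lambda>x. fst (family (\<psi> x)) $ i) \<in> R" "(\<lambda>x. snd (family (\<psi> x)) $ j) \<in> R"
  using coeffs_in_family[of \<psi>, OF assms]
  unfolding family_def weierstrass_of_def vec_of_def coeffs_in_def by simp_all

end

lemma continuous_on_family: "continuous_on UNIV family"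
proof -
  have "(\<lambda>x :: complex ^ 27. x $ k) \<in> {f. continuous_on UNIV f}" for k
    by (auto intro: continuous_intros)
  note mem = cont_fun.family_mem[of "\<lambda>x. x", OF this]
  have "continuous_on UNIV (\<lambda>x. \<chi> i. fst (family x) $ i)"
    by (rule continuous_on_vec_lambda) (use mem(1) in blast)
  moreover have "continuous_on UNIV (\<lambda>x. \<chi> j. snd (family x) $ j)"
    by (rule continuous_on_vec_lambda) (use mem(2) in blast)
  ultimately have "continuous_on UNIV (\<lambda>x. (\<chi> i. fst (family x) $ i, \<chi> j. snd (family x) $ j))"
    by (rule continuous_on_Pair)
  then show ?thesis
    by simp
qed

text \<open>
  The inequality says that the two vectors are linearly independent, so that they represent two
  different points.
\<close>

definition marked_locus :: "weierstrass set \<Rightarrow> (complex ^ 27) set" where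
  "marked_locus U = {x. family x \<in> U \<and>
     fst (mark1 x) * snd (mark2 x) \<noteq> snd (mark1 x) * fst (mark2 x)}"

lemma cofinite_on_lines_marked_locus:
  assumes "zariski_open U"
  shows "cofinite_on_lines (marked_locus U)"
  unfolding cofinite_on_lines_def
proof (intro ballI allI)
  fix a b :: "complex ^ 27" assume a: "a \<in> marked_locus U"
  obtain F where F: "F \<subseteq> polynomial_functions" "U = - {E. \<forall>f\<in>F. f E = 0}"
    using assms unfolding zariski_open_def by blast
  obtain f where f: "f \<in> F" "f (family a) \<noteq> 0"
    using a F(2) by (auto simp: marked_locus_def)
  (* On a line through a point of the locus, the parameters outside the locus are zeros of g or h. *)
  define g where "g z = f (family (complex_line a b z))" for z
  define h where "h z = complex_line a b z $ 0 * complex_line a b z $ 3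
    + - (complex_line a b z $ 1 * complex_line a b z $ 2)" for z
  have "g \<in> range poly"
    unfolding g_def
    by (rule line_fun.polynomial_functions_comp_mem[OF _ line_fun.family_mem(1) line_fun.family_mem(2)])
      (use f(1) F(1) in blast, (rule complex_line_mem)+)
  moreover have "h \<in> range poly"
    unfolding h_def
    by (intro line_fun.add_mem line_fun.uminus_mem line_fun.mult_mem complex_line_mem)
  moreover have "g 0 \<noteq> 0" "h 0 \<noteq> 0"
    using f(2) a by (simp_all add: g_def h_def marked_locus_def mark1_def mark2_def)
  ultimately have "finite ({z. g z = 0} \<union> {z. h z = 0})"
    using finite_zeros by blast
  moreover have "{z. complex_line a b z \<notin> marked_locus U} \<subseteq> {z. g z = 0} \<union> {z. h z = 0}"
    using f(1) F(2) by (auto simp: marked_locus_def mark1_def mark2_def g_def h_def)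
  ultimately show "finite {z. complex_line a b z \<notin> marked_locus U}"
    by (rule rev_finite_subset)
qed

section \<open>A member with a double zero and 22 simple zeros\<close>

text \<open>
  Take both marked points to be 0, \<open>C = 1\<close>, \<open>P = 0\<close> and \<open>Q = z^10 + 1\<close>. Then \<open>A = -3\<close>,
  \<open>B = 2 + z^2 (z^10 + 1)\<close>, and the discriminant is \<open>27 (B - 2) (B + 2)\<close>, that is
  \<open>27 z^2 (z^10 + 1) (z^12 + z^2 + 4)\<close>.
\<close>

lemma family_with_double_zero:
  obtains x0 where "mark1 x0 = (0, 1)" "mark2 x0 = (0, 1)" "coeff (disc_poly (family x0)) 24 \<noteq> 0"
    "card {z. z \<noteq> 0 \<and> poly (disc_poly (family x0)) z = 0} = 22"
proof -
  obtain x0 where x0: "mark1 x0 = (0, 1)" "mark2 x0 = (0, 1)" "cusp_param x0 = 1"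
    "cofactor_A x0 = 0" "cofactor_B x0 = monom 1 10 + 1"
  proof (rule params_exist[of 1 0 "monom 1 10 + 1" "(0, 1)" "(0, 1)"])
    show "degree (monom 1 10 + 1 :: complex poly) \<le> 10"
      by (intro degree_add_le) (simp_all add: degree_monom_eq)
  qed (auto simp: that)
  have A: "family_A x0 = [:-3:]"
    by (simp add: family_A_def x0 linear_form_def)
  have B: "family_B x0 = smult 2 1 + [:0, 1:] * [:0, 1:] * (monom 1 10 + 1)"
    by (simp add: family_B_def x0 linear_form_def)
  have poly_disc: "poly (disc_poly (family x0)) z = 27 * z ^ 2 * ((z ^ 10 + 1) * (z ^ 12 + z ^ 2 + 4))" for z
  proof -
    have "z ^ 12 = z ^ 2 * z ^ 10"
      by (simp flip: power_add)
    then have B': "poly (family_B x0) z = 2 + z ^ 12 + z ^ 2" "z ^ 2 * (z ^ 10 + 1) = z ^ 12 + z ^ 2"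
      by (simp_all add: B poly_monom power2_eq_square algebra_simps)
    have "poly (disc_poly (family x0)) z = 27 * (2 + z ^ 12 + z ^ 2) ^ 2 - 108"
      by (simp add: discriminant_poly_def poly_family A B'(1))
    also have "\<dots> = 27 * ((z ^ 12 + z ^ 2) * (z ^ 12 + z ^ 2 + 4))"
      by (simp add: power2_eq_square algebra_simps)
    finally show ?thesis
      unfolding B'(2)[symmetric] by (simp add: mult.assoc)
  qed
  (* Infinity is not a zero, so none of the 24 zeros is missed in the affine coordinate. *)
  have "coeff (family_B x0 ^ 2) (12 + 12) = coeff (family_B x0) 12 * coeff (family_B x0) 12"
    unfolding power2_eq_square by (rule coeff_mult_top) (rule degree_family)+
  moreover have "coeff (family_B x0) 12 = 1"
    by (simp add: B coeff_pCons numeral_eq_Suc)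
  ultimately have lead: "coeff (disc_poly (family x0)) 24 \<noteq> 0"
    by (simp add: discriminant_poly_def poly_family A coeff_pCons power3_eq_cube)
  (* Up to a constant the discriminant without its double zero; h and its derivative have no common root. *)
  define h :: "complex poly" where "h = (monom 1 10 + 1) * (monom 1 12 + monom 1 2 + [:4:])"
  have poly_h: "poly h z = (z ^ 10 + 1) * (z ^ 12 + z ^ 2 + 4)" for z
    by (simp add: h_def poly_monom)
  have "degree (monom 1 10 + 1 :: complex poly) = 10"
    by (subst degree_add_eq_left) (simp_all add: degree_monom_eq)
  moreover have "degree (monom 1 12 + monom 1 2 + [:4:] :: complex poly) = 12"
    by (simp add: add.assoc) (subst degree_add_eq_left, auto simp: degree_monom_eq intro!: degree_add_less)
  ultimately have deg_h: "degree h = 22"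
    unfolding h_def by (subst degree_mult_eq) auto
  have "card {z. poly h z = 0} = degree h"
  proof (rule card_roots)
    fix a assume "poly h a = 0"
    then have "a ^ 10 + 1 = 0 \<or> a ^ 12 + a ^ 2 + 4 = 0"
      by (simp add: poly_h)
    then consider "a ^ 10 + 1 = 0" | "a ^ 12 + a ^ 2 + 4 = 0" "a ^ 10 + 1 \<noteq> 0"
      by blast
    moreover have deriv: "poly (pderiv h) a
      = (a ^ 10 + 1) * (12 * a ^ 11 + 2 * a) + (a ^ 12 + a ^ 2 + 4) * (10 * a ^ 9)"
      by (simp add: h_def pderiv_mult pderiv_add pderiv_monom pderiv_pCons poly_monom)
    have a12: "a ^ 12 = a ^ 10 * a ^ 2"
      by (simp flip: power_add)
    ultimately show "poly (pderiv h) a \<noteq> 0"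
    proof cases
      case 1
      then have "a \<noteq> 0" "a ^ 10 = - 1"
        by (auto simp: eq_neg_iff_add_eq_0)
      then show ?thesis
        by (simp add: deriv a12)
    next
      case 2
      have "12 * a ^ 11 + 2 * a \<noteq> 0"
      proof
        assume "12 * a ^ 11 + 2 * a = 0"
        moreover have "12 * a ^ 11 + 2 * a = a * (12 * a ^ 10 + 2)"
          by (simp add: algebra_simps flip: power_Suc)
        moreover have "a \<noteq> 0"
          using 2(1) by auto
        ultimately have twelve: "12 * a ^ 10 = - 2"
          by (simp add: eq_neg_iff_add_eq_0)
        have "a ^ 10 = 12 * a ^ 10 / 12"
          by simp
        also have "\<dots> = - (1 / 6)"
          unfolding twelve by simp
        finally have a10: "a ^ 10 = - (1 / 6)" .
        have "5 / 6 * a ^ 2 + 4 = 0"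
          using 2(1) unfolding a12 a10 by (simp add: field_simps)
        then have "5 / 6 * a ^ 2 = - 4"
          by (simp add: eq_neg_iff_add_eq_0)
        moreover have "a ^ 2 = 6 / 5 * (5 / 6 * a ^ 2)"
          by simp
        ultimately have "a ^ 2 = - (24 / 5)"
          by simp
        then have "a ^ 10 = (- (24 / 5)) ^ 5"
          using power_mult[of a 2 5] by simp
        then show False
          using a10 by (simp add: power_divide)
      qed
      then show ?thesis
        using 2 by (simp add: deriv)
    qed
  qed
  moreover have "{z. z \<noteq> 0 \<and> poly (disc_poly (family x0)) z = 0} = {z. poly h z = 0}"
    by (auto simp: poly_disc poly_h)
  ultimately show thesis
    using that[of x0] x0 lead deg_h by simp
qed

section \<open>Swapping two zeros\<close>

definition point1 :: "complex ^ 27 \<Rightarrow> cp1" where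
  "point1 x = abs_cp1 (mark1 x)"

definition point2 :: "complex ^ 27 \<Rightarrow> cp1" where
  "point2 x = abs_cp1 (mark2 x)"

lemma point_swap_marks [simp]: "point1 (swap_marks x) = point2 x" "point2 (swap_marks x) = point1 x"
  by (simp_all add: point1_def point2_def)

lemma marked_locusD:
  assumes "x \<in> marked_locus U"
  shows "family x \<in> U" "mark1 x \<noteq> 0" "mark2 x \<noteq> 0" "point1 x \<noteq> point2 x"
    "discriminant_vanishes (family x) (point1 x)" "discriminant_vanishes (family x) (point2 x)"
    "swap_marks x \<in> marked_locus U"
proof -
  have cross: "fst (mark1 x) * snd (mark2 x) \<noteq> snd (mark1 x) * fst (mark2 x)"
    using assms by (simp add: marked_locus_def)
  show "family x \<in> U"
    using assms by (simp add: marked_locus_def)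
  show nz: "mark1 x \<noteq> 0" "mark2 x \<noteq> 0"
    using cross by auto
  show "point1 x \<noteq> point2 x"
    using cross by (simp add: point1_def point2_def abs_cp1_eq_iff nz)
  show "discriminant_vanishes (family x) (point1 x)" "discriminant_vanishes (family x) (point2 x)"
    by (simp_all add: point1_def point2_def discriminant_vanishes_abs_cp1 nz discriminant_family_marks)
  show "swap_marks x \<in> marked_locus U"
    using assms cross by (simp add: marked_locus_def family_swap_marks mult.commute eq_commute)
qed

lemma continuous_on_marks: "continuous_on D mark1" "continuous_on D mark2"
  unfolding mark1_def mark2_def by (intro continuous_intros)+

lemma continuous_on_points:
  "continuous_on (marked_locus U) point1" "continuous_on (marked_locus U) point2"
proof -
  show "continuous_on (marked_locus U) point1"
    unfolding point1_def
    by (rule continuous_on_compose2[OF continuous_on_abs_cp1 continuous_on_marks(1)])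
      (use marked_locusD(2) in auto)
  show "continuous_on (marked_locus U) point2"
    unfolding point2_def
    by (rule continuous_on_compose2[OF continuous_on_abs_cp1 continuous_on_marks(2)])
      (use marked_locusD(3) in auto)
qed

lemma connected_subset_cell:
  assumes "connected T" "T \<subseteq> (\<Union>i\<in>I. D i)" "\<And>i. i \<in> I \<Longrightarrow> open (D i)"
    and "\<And>i j. i \<in> I \<Longrightarrow> j \<in> I \<Longrightarrow> i \<noteq> j \<Longrightarrow> D i \<inter> D j = {}"
    and "k \<in> I" "t \<in> T" "t \<in> D k"
  shows "T \<subseteq> D k"
proof -
  have "open (\<Union>i\<in>I - {k}. D i)"
    using assms(3) by blast
  moreover have "D k \<inter> (\<Union>i\<in>I - {k}. D i) \<inter> T = {}"
    using assms(4,5) by blast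
  moreover have "T \<subseteq> D k \<union> (\<Union>i\<in>I - {k}. D i)"
    using assms(2) by blast
  ultimately have "D k \<inter> T = {} \<or> (\<Union>i\<in>I - {k}. D i) \<inter> T = {}"
    using connectedD[OF assms(1) assms(3)[OF assms(5)]] by blast
  then show ?thesis
    using assms(2,6,7) by blast
qed

text \<open>
  Near the parameters of the previous example, 22 zeros stay in their own small discs while the two
  marked zeros stay in a disc around 0. Choose \<open>x\<close> close to them and a short path \<open>\<omega>\<close> from \<open>x\<close> to
  its swap: the lift of a zero other than the marked ones cannot leave its disc, where there is only
  one zero, so it returns to its starting point.
\<close>

lemma local_swap:
  assumes U: "zariski_open U" "unbranched_over 24 Z fst U" and ne: "marked_locus U \<noteq> {}"
  obtains x \<omega> where "x \<in> marked_locus U" "path \<omega>" "path_image \<omega> \<subseteq> marked_locus U"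
    "pathstart \<omega> = x" "pathfinish \<omega> = swap_marks x"
    "\<And>y y'. lift_joins Z fst (family \<circ> \<omega>) y y' \<Longrightarrow> y \<noteq> (family x, point1 x)
      \<Longrightarrow> y \<noteq> (family x, point2 x) \<Longrightarrow> y' = y"
proof -
  obtain x0 where x0: "mark1 x0 = (0, 1)" "mark2 x0 = (0, 1)" "coeff (disc_poly (family x0)) 24 \<noteq> 0"
    "card {z. z \<noteq> 0 \<and> poly (disc_poly (family x0)) z = 0} = 22"
    by (rule family_with_double_zero)
  define Q where "Q = {z. z \<noteq> 0 \<and> poly (disc_poly (family x0)) z = 0}"
  have Q: "finite Q" "card Q = 22" "0 \<notin> Q"
    using x0(4) by (auto simp: Q_def intro: card_ge_0_finite)
  obtain \<epsilon> where \<epsilon>: "\<epsilon> > 0"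
    and sep: "\<And>z z'. z \<in> insert 0 Q \<Longrightarrow> z' \<in> insert 0 Q \<Longrightarrow> z \<noteq> z' \<Longrightarrow> ball z \<epsilon> \<inter> ball z' \<epsilon> = {}"
    using finite_set_separated[of "insert 0 Q"] Q(1) by (metis finite_insert)
  (* The cell of 0 is meant for the marked points, the other cells for the 22 further zeros. *)
  define D where "D z = affine_point ` ball z \<epsilon>" for z
  have D_open: "open (D z)" for z
    by (simp add: D_def open_affine_image)
  have D_disj: "D z \<inter> D z' = {}" if "z \<in> insert 0 Q" "z' \<in> insert 0 Q" "z \<noteq> z'" for z z'
    using sep[OF that] by (auto simp: D_def)
  define zeros where "zeros x = {q. discriminant_vanishes (family x) q}" for x
  have card_zeros: "finite (zeros x)" "card (zeros x) = 24" if "family x \<in> U" for x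
  proof -
    have fibre: "fibre Z fst (family x) = Pair (family x) ` zeros x"
      by (simp add: fibre_Z zeros_def)
    have inj: "inj_on (Pair (family x)) (zeros x)"
      by (simp add: inj_on_def)
    have "finite (fibre Z fst (family x))" "card (fibre Z fst (family x)) = 24"
      using U(2) that unfolding unbranched_over_def by blast+
    then show "finite (zeros x)" "card (zeros x) = 24"
      unfolding fibre finite_image_iff[OF inj] card_image[OF inj] by blast+
  qed
  have "\<forall>\<^sub>F x in nhds x0. \<forall>z\<in>Q. zeros x \<inter> D z \<noteq> {}"
  proof (intro eventually_ball_finite Q(1) ballI)
    fix z assume z: "z \<in> Q"
    have "cont_fun.coeffs_in (\<lambda>x. disc_poly (family x))"
      unfolding poly_family
      by (intro cont_fun.coeffs_in_discriminant_poly cont_fun.coeffs_in_family) (auto intro: continuous_intros)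
    then have "\<forall>\<^sub>F x in nhds x0. \<exists>w. poly (disc_poly (family x)) w = 0 \<and> dist w z < \<epsilon>"
      by (rule nearby_root) (use x0(3) z \<epsilon> in \<open>auto simp: degree_disc_poly Q_def\<close>)
    then show "\<forall>\<^sub>F x in nhds x0. zeros x \<inter> D z \<noteq> {}"
    proof eventually_elim
      case (elim x)
      then obtain w where "poly (disc_poly (family x)) w = 0" "dist w z < \<epsilon>"
        by blast
      then have "affine_point w \<in> zeros x \<inter> D z"
        by (auto simp: zeros_def D_def vanishes_affine_point dist_commute)
      then show ?case
        by blast
    qed
  qed
  moreover have near0: "\<forall>\<^sub>F x in nhds x0. abs_cp1 (m x) \<in> D 0"
    if m: "continuous_on UNIV m" "m x0 = (0, 1)" for m :: "complex ^ 27 \<Rightarrow> complex \<times> complex"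
  proof -
    have "open ({v. v \<noteq> 0 \<and> abs_cp1 v \<in> D 0})"
      using D_open[of 0] by (simp add: open_cp1_def)
    then have "open (m -` {v. v \<noteq> 0 \<and> abs_cp1 v \<in> D 0})"
      using m(1) by (rule open_vimage)
    moreover have "x0 \<in> m -` {v. v \<noteq> 0 \<and> abs_cp1 v \<in> D 0}"
      using \<epsilon> by (simp add: m(2) D_def flip: affine_point_def)
    ultimately show ?thesis
      unfolding eventually_nhds by blast
  qed
  ultimately have "\<forall>\<^sub>F x in nhds x0. (\<forall>z\<in>Q. zeros x \<inter> D z \<noteq> {}) \<and> point1 x \<in> D 0 \<and> point2 x \<in> D 0"
    using near0[OF continuous_on_marks(1) x0(1)] near0[OF continuous_on_marks(2) x0(2)]
    unfolding point1_def point2_def by (intro eventually_conj)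
  then obtain W0 where W0: "open W0" "x0 \<in> W0"
    "\<And>x. x \<in> W0 \<Longrightarrow> (\<forall>z\<in>Q. zeros x \<inter> D z \<noteq> {}) \<and> point1 x \<in> D 0 \<and> point2 x \<in> D 0"
    unfolding eventually_nhds by blast
  then obtain e where e: "e > 0" "ball x0 e \<subseteq> W0"
    using open_contains_ball by blast
  define W where "W = ball x0 e"
  have W: "open W" "convex W" "x0 \<in> W" "W \<subseteq> W0"
    using e by (auto simp: W_def)
  have cells: "zeros x - {point1 x, point2 x} \<subseteq> (\<Union>z\<in>Q. D z)"
    "\<And>z. z \<in> Q \<Longrightarrow> \<exists>w. (zeros x - {point1 x, point2 x}) \<inter> D z = {w}"
    if x: "x \<in> W \<inter> marked_locus U" for x
  proof -
    let ?F = "zeros x - {point1 x, point2 x}"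
    have xU: "family x \<in> U" and pts: "point1 x \<in> zeros x" "point2 x \<in> zeros x" "point1 x \<noteq> point2 x"
      using marked_locusD[of x U] x by (auto simp: zeros_def)
    have W0x: "\<forall>z\<in>Q. zeros x \<inter> D z \<noteq> {}" "point1 x \<in> D 0" "point2 x \<in> D 0"
      using W0(3)[of x] W(4) x by auto
    have fin: "finite ?F"
      using card_zeros(1)[OF xU] by simp
    (* 24 zeros minus the two marked ones. *)
    have card: "card ?F = card Q"
      using card_zeros[OF xU] pts Q(2) by (simp add: card_Diff_subset)
    have hit: "?F \<inter> D z \<noteq> {}" if z: "z \<in> Q" for z
    proof -
      have "D z \<inter> D 0 = {}"
        using D_disj[of z 0] z Q(3) by blast
      then show ?thesis
        using W0x z by blast
    qed
    have disj: "D z \<inter> D z' = {}" if "z \<in> Q" "z' \<in> Q" "z \<noteq> z'" for z z'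
      using D_disj that by blast
    note * = one_point_per_cell[of ?F Q D, OF fin Q(1) card hit disj]
    show "?F \<subseteq> (\<Union>z\<in>Q. D z)"
      by (rule *(1))
    show "\<exists>w. ?F \<inter> D z = {w}" if "z \<in> Q" for z
      by (rule *(2)[OF _ _ _ _ that])
  qed
  have "swap_marks x0 = x0"
    using x0(1,2) by (auto simp: swap_marks_def mark1_def mark2_def Finite_Cartesian_Product.vec_eq_iff)
  then have "x0 \<in> W \<inter> swap_marks -` W"
    using W(3) by simp
  moreover have "open (W \<inter> swap_marks -` W)"
    by (intro open_Int W(1) open_vimage continuous_on_swap_marks)
  (* The locus is dense, so x can be taken so close to x0 that its swap lies in W too. *)
  ultimately have "(W \<inter> swap_marks -` W) \<inter> marked_locus U \<noteq> {}"
    using open_Int_cofinite_nonempty cofinite_on_lines_marked_locus[OF U(1)] ne by (metis ex_in_conv)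
  then obtain x where x: "x \<in> W" "swap_marks x \<in> W" "x \<in> marked_locus U"
    by blast
  have "path_connected (W \<inter> marked_locus U)"
    by (rule path_connected_convex_Int_cofinite[OF W(1,2) cofinite_on_lines_marked_locus[OF U(1)]])
  then obtain \<omega> where \<omega>: "path \<omega>" "path_image \<omega> \<subseteq> W \<inter> marked_locus U"
    "pathstart \<omega> = x" "pathfinish \<omega> = swap_marks x"
    using x marked_locusD(7)[OF x(3)] unfolding path_connected_def by blast
  have "y' = y"
    if lift: "lift_joins Z fst (family \<circ> \<omega>) y y'"
      and y: "y \<noteq> (family x, point1 x)" "y \<noteq> (family x, point2 x)" for y y'
  proof -
    obtain \<eta> where \<eta>: "path \<eta>" "path_image \<eta> \<subseteq> Z" "\<And>t. t \<in> {0..1} \<Longrightarrow> fst (\<eta> t) = family (\<omega> t)"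
      "\<eta> 0 = y" "\<eta> 1 = y'"
      using lift unfolding lift_joins_def pathstart_def pathfinish_def by auto
    have ends: "\<omega> 0 = x" "\<omega> 1 = swap_marks x"
      using \<omega>(3,4) by (simp_all add: pathstart_def pathfinish_def)
    have zero: "snd (\<eta> t) \<in> zeros (\<omega> t)" if "t \<in> {0..1}" for t
    proof -
      have "\<eta> t \<in> Z"
        using \<eta>(2) that by (auto simp: path_image_def)
      then show ?thesis
        using \<eta>(3)[OF that] by (cases "\<eta> t") (auto simp: Z_def zeros_def)
    qed
    have in_cells: "snd (\<eta> t) \<in> (\<Union>z\<in>insert 0 Q. D z)" if t: "t \<in> {0..1}" for t
    proof -
      have \<omega>t: "\<omega> t \<in> W \<inter> marked_locus U"
        using \<omega>(2) t by (auto simp: path_image_def)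
      then have "point1 (\<omega> t) \<in> D 0" "point2 (\<omega> t) \<in> D 0"
        using W0(3) W(4) by blast+
      moreover have "snd (\<eta> t) \<in> (\<Union>z\<in>Q. D z)" if "snd (\<eta> t) \<notin> {point1 (\<omega> t), point2 (\<omega> t)}"
        by (rule subsetD[OF cells(1)[OF \<omega>t]]) (use that zero[OF t] in simp)
      ultimately show ?thesis
        by (cases "snd (\<eta> t) \<in> {point1 (\<omega> t), point2 (\<omega> t)}") auto
    qed
    have y_eq: "y = (family x, snd y)" "y' = (family x, snd y')"
      using \<eta>(3)[of 0] \<eta>(3)[of 1] \<eta>(4,5) ends by (auto simp: family_swap_marks prod_eq_iff)
    have F: "snd y \<in> zeros x - {point1 x, point2 x}" "snd y' \<in> zeros x"
      using zero[of 0] zero[of 1] y y_eq \<eta>(4,5) ends by (auto simp: zeros_def family_swap_marks)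
    obtain z where z: "z \<in> Q" "snd y \<in> D z"
      using cells(1)[of x] x F(1) by blast
    (* By connectedness the lift stays in the cell of z, which contains only one zero at the end. *)
    have "path (snd \<circ> \<eta>)"
      using \<eta>(1) by (intro path_continuous_image continuous_intros)
    then have "connected ((snd \<circ> \<eta>) ` {0..1})"
      unfolding path_def by (rule connected_continuous_image) simp
    moreover have "(snd \<circ> \<eta>) ` {0..1} \<subseteq> (\<Union>z\<in>insert 0 Q. D z)"
      unfolding comp_def by (intro image_subsetI in_cells)
    ultimately have "(snd \<circ> \<eta>) ` {0..1} \<subseteq> D z"
    proof (rule connected_subset_cell)
      show "snd y \<in> (snd \<circ> \<eta>) ` {0..1}"
        using \<eta>(4) by (intro image_eqI[of _ _ 0]) auto
    qed (use z D_open D_disj in auto)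
    moreover have "snd y' \<in> (snd \<circ> \<eta>) ` {0..1}"
      using \<eta>(5) by (intro image_eqI[of _ _ 1]) auto
    ultimately have y'D: "snd y' \<in> D z"
      by blast
    have "point1 x \<in> D 0" "point2 x \<in> D 0"
      using W0(3)[of x] W(4) x(1) by auto
    moreover have "D z \<inter> D 0 = {}"
      using D_disj[of z 0] z(1) Q(3) by blast
    ultimately have "snd y' \<noteq> point1 x" "snd y' \<noteq> point2 x"
      using y'D by auto
    then have "snd y' \<in> (zeros x - {point1 x, point2 x}) \<inter> D z"
      using y'D F(2) by simp
    moreover have "snd y \<in> (zeros x - {point1 x, point2 x}) \<inter> D z"
      using F(1) z(2) by blast
    moreover obtain w where "(zeros x - {point1 x, point2 x}) \<inter> D z = {w}"
      using cells(2)[of x z] x z(1) by blast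
    ultimately have "snd y' = snd y"
      by simp
    then show ?thesis
      using y_eq by metis
  qed
  then show thesis
    using that[of x \<omega>] x(3) \<omega> by blast
qed

text \<open>
  The marked points are continuous sections over any path of parameters, hence are carried along.
\<close>

lemma family_transport:
  assumes U: "unbranched_over 24 Z fst U"
    and \<xi>: "path \<xi>" "path_image \<xi> \<subseteq> marked_locus U"
  obtains \<sigma> where "bij_betw \<sigma> (fibre Z fst (family (pathstart \<xi>))) (fibre Z fst (family (pathfinish \<xi>)))"
    "\<And>y. y \<in> fibre Z fst (family (pathstart \<xi>)) \<Longrightarrow> lift_joins Z fst (family \<circ> \<xi>) y (\<sigma> y)"
    "\<sigma> (family (pathstart \<xi>), point1 (pathstart \<xi>)) = (family (pathfinish \<xi>), point1 (pathfinish \<xi>))"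
    "\<sigma> (family (pathstart \<xi>), point2 (pathstart \<xi>)) = (family (pathfinish \<xi>), point2 (pathfinish \<xi>))"
proof -
  let ?C = "Z \<inter> fst -` U"
  define S where "S = {\<lambda>t. (family (\<xi> t), point1 (\<xi> t)), \<lambda>t. (family (\<xi> t), point2 (\<xi> t))}"
  have cov: "covering_space ?C fst U"
    using U by (simp add: unbranched_over_def)
  have \<xi>t: "\<xi> t \<in> marked_locus U" if "t \<in> {0..1}" for t
    using \<xi>(2) that by (auto simp: path_image_def)
  have path: "path (family \<circ> \<xi>)"
    by (rule path_continuous_image[OF \<xi>(1)]) (rule continuous_on_subset[OF continuous_on_family], simp)
  have cont_\<xi>: "continuous_on {0..1} \<xi>"
    using \<xi>(1) by (simp add: path_def)
  have image: "path_image (family \<circ> \<xi>) \<subseteq> U"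
    using \<xi>t marked_locusD(1) by (auto simp: path_image_def)
  have cont: "continuous_on {0..1} (\<lambda>t. (family (\<xi> t), point1 (\<xi> t)))"
    "continuous_on {0..1} (\<lambda>t. (family (\<xi> t), point2 (\<xi> t)))"
    by (intro continuous_on_Pair continuous_on_compose2[OF continuous_on_family cont_\<xi>]
      continuous_on_compose2[OF continuous_on_points(1) cont_\<xi>, of U]
      continuous_on_compose2[OF continuous_on_points(2) cont_\<xi>, of U]; use \<xi>t in blast)+
  have S: "continuous_on {0..1} s \<and> (\<forall>t\<in>{0..1}. s t \<in> ?C \<and> fst (s t) = (family \<circ> \<xi>) t)" if "s \<in> S" for s
    using that cont marked_locusD(1)[OF \<xi>t] marked_locusD(5)[OF \<xi>t] marked_locusD(6)[OF \<xi>t]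
    unfolding S_def by (auto simp: Z_def)
  have fibres: "fibre ?C fst p = fibre Z fst p" if "p \<in> U" for p
    using that by (auto simp: fibre_def)
  have ends: "pathstart (family \<circ> \<xi>) = family (pathstart \<xi>)" "pathfinish (family \<circ> \<xi>) = family (pathfinish \<xi>)"
    "family (pathstart \<xi>) \<in> U" "family (pathfinish \<xi>) \<in> U"
    using \<xi>t[of 0] \<xi>t[of 1] marked_locusD(1) by (auto simp: pathstart_def pathfinish_def)
  have "finite S"
    by (simp add: S_def)
  from covering_space_path_transport[OF cov path image this S]
  obtain \<sigma> where \<sigma>: "bij_betw \<sigma> (fibre ?C fst (pathstart (family \<circ> \<xi>))) (fibre ?C fst (pathfinish (family \<circ> \<xi>)))"
    "\<And>y. y \<in> fibre ?C fst (pathstart (family \<circ> \<xi>)) \<Longrightarrow> lift_joins ?C fst (family \<circ> \<xi>) y (\<sigma> y)"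
    "\<And>s. s \<in> S \<Longrightarrow> \<sigma> (s 0) = s 1"
    by metis
  show thesis
  proof (rule that[of \<sigma>])
    show "bij_betw \<sigma> (fibre Z fst (family (pathstart \<xi>))) (fibre Z fst (family (pathfinish \<xi>)))"
      using \<sigma>(1) by (simp add: ends fibres)
    show "lift_joins Z fst (family \<circ> \<xi>) y (\<sigma> y)" if "y \<in> fibre Z fst (family (pathstart \<xi>))" for y
      using \<sigma>(2)[of y] that by (auto simp: ends fibres intro: lift_joins_mono)
    show "\<sigma> (family (pathstart \<xi>), point1 (pathstart \<xi>)) = (family (pathfinish \<xi>), point1 (pathfinish \<xi>))"
      "\<sigma> (family (pathstart \<xi>), point2 (pathstart \<xi>)) = (family (pathfinish \<xi>), point2 (pathfinish \<xi>))"
      using \<sigma>(3)[of "\<lambda>t. (family (\<xi> t), point1 (\<xi> t))"] \<sigma>(3)[of "\<lambda>t. (family (\<xi> t), point2 (\<xi> t))"]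
      by (simp_all add: S_def pathstart_def pathfinish_def)
  qed
qed

text \<open>
  Choose parameters \<open>a\<close> over \<open>p\<close> with marked points \<open>y\<close> and \<open>y'\<close>, move along a path \<open>\<xi>\<close> to the
  point \<open>b\<close> where the marked zeros can be swapped locally, swap them, and return along the reversed
  path. The conjugate of the local transposition exchanges \<open>y\<close> and \<open>y'\<close>.
\<close>

lemma transposition_in_monodromy_group:
  assumes U: "zariski_open U" "unbranched_over 24 Z fst U" and p: "p \<in> U"
    and y: "y \<in> fibre Z fst p" and y': "y' \<in> fibre Z fst p" and "y \<noteq> y'"
  shows "Transposition.transpose y y' \<in> monodromy_group Z fst U p"
proof -
  obtain q q' where q: "y = (p, q)" "y' = (p, q')" "q \<noteq> q'"
    "discriminant_vanishes p q" "discriminant_vanishes p q'"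
    using y y' \<open>y \<noteq> y'\<close> by (auto simp: fibre_Z)
  obtain v where v: "v \<noteq> 0" "q = abs_cp1 v"
    by (rule cp1_cases)
  obtain w where w: "w \<noteq> 0" "q' = abs_cp1 w"
    by (rule cp1_cases)
  have cross: "fst v * snd w \<noteq> snd v * fst w"
    using q(3) v w by (simp add: abs_cp1_eq_iff)
  obtain a where a: "family a = p" "mark1 a = v" "mark2 a = w"
    using family_surj[of v p w] v w q(4,5) cross by (auto simp: discriminant_vanishes_abs_cp1)
  have a_mem: "a \<in> marked_locus U"
    using a p cross by (simp add: marked_locus_def)
  have y_eq: "y = (family a, point1 a)" "y' = (family a, point2 a)"
    using a q v w by (simp_all add: point1_def point2_def)
  have ne: "marked_locus U \<noteq> {}"
    using a_mem by blast
  obtain b \<omega> where b: "b \<in> marked_locus U" and \<omega>: "path \<omega>" "path_image \<omega> \<subseteq> marked_locus U"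
    "pathstart \<omega> = b" "pathfinish \<omega> = swap_marks b"
    "\<And>u u'. lift_joins Z fst (family \<circ> \<omega>) u u' \<Longrightarrow> u \<noteq> (family b, point1 b)
      \<Longrightarrow> u \<noteq> (family b, point2 b) \<Longrightarrow> u' = u"
    using local_swap[OF U ne] by metis
  have "path_connected (UNIV \<inter> marked_locus U)"
    by (intro path_connected_convex_Int_cofinite cofinite_on_lines_marked_locus U) auto
  then have "path_connected (marked_locus U)"
    by simp
  then obtain \<xi> where \<xi>: "path \<xi>" "path_image \<xi> \<subseteq> marked_locus U" "pathstart \<xi> = a" "pathfinish \<xi> = b"
    using a_mem b unfolding path_connected_def by blast
  obtain \<sigma> where \<sigma>: "bij_betw \<sigma> (fibre Z fst (family a)) (fibre Z fst (family b))"
    "\<And>u. u \<in> fibre Z fst (family a) \<Longrightarrow> lift_joins Z fst (family \<circ> \<xi>) u (\<sigma> u)"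
    "\<sigma> y = (family b, point1 b)" "\<sigma> y' = (family b, point2 b)"
    using family_transport[OF U(2) \<xi>(1,2)] unfolding \<xi>(3,4) y_eq by metis
  obtain \<rho> where \<rho>: "\<And>u. u \<in> fibre Z fst (family b) \<Longrightarrow> lift_joins Z fst (family \<circ> \<omega>) u (\<rho> u)"
    "\<rho> (family b, point1 b) = (family b, point2 b)" "\<rho> (family b, point2 b) = (family b, point1 b)"
    using family_transport[OF U(2) \<omega>(1,2)] unfolding \<omega>(3,4) family_swap_marks point_swap_marks by metis
  define \<gamma> where "\<gamma> = (family \<circ> \<xi>) +++ ((family \<circ> \<omega>) +++ reversepath (family \<circ> \<xi>))"
  have "lift_joins Z fst \<gamma> u (Transposition.transpose y y' u)" if u: "u \<in> fibre Z fst p" for u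
  proof -
    let ?u = "Transposition.transpose y y' u"
    have u': "?u \<in> fibre Z fst p"
      using u y y' by (auto simp: Transposition.transpose_def)
    have \<sigma>u: "\<sigma> u \<in> fibre Z fst (family b)"
      using \<sigma>(1) u a(1) by (auto simp: bij_betw_def)
    have inj: "\<sigma> u = \<sigma> s \<longleftrightarrow> u = s" if "s \<in> fibre Z fst p" for s
      using \<sigma>(1) u that a(1) by (auto simp: bij_betw_def inj_on_eq_iff)
    have "\<rho> (\<sigma> u) = \<sigma> ?u"
    proof (cases "u = y \<or> u = y'")
      case True
      then show ?thesis
        using \<sigma>(3,4) \<rho>(2,3) by auto
    next
      case False
      then have "\<sigma> u \<noteq> (family b, point1 b)" "\<sigma> u \<noteq> (family b, point2 b)"
        using inj[OF y] inj[OF y'] \<sigma>(3,4) by auto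
      then have "\<rho> (\<sigma> u) = \<sigma> u"
        using \<omega>(5) \<rho>(1)[OF \<sigma>u] by blast
      then show ?thesis
        using False by (simp add: Transposition.transpose_def)
    qed
    then have "lift_joins Z fst (family \<circ> \<omega>) (\<sigma> u) (\<sigma> ?u)"
      using \<rho>(1)[OF \<sigma>u] by simp
    moreover have "lift_joins Z fst (reversepath (family \<circ> \<xi>)) (\<sigma> ?u) ?u"
      using \<sigma>(2) u' a(1) by (intro lift_joins_reversepath) simp
    moreover have "lift_joins Z fst (family \<circ> \<xi>) u (\<sigma> u)"
      using \<sigma>(2) u a(1) by simp
    ultimately show ?thesis
      unfolding \<gamma>_def by (intro lift_joins_joinpaths)
  qed
  moreover have "path \<gamma> \<and> path_image \<gamma> \<subseteq> U \<and> pathstart \<gamma> = p \<and> pathfinish \<gamma> = p"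
  proof -
    have paths: "path (family \<circ> \<xi>)" "path (family \<circ> \<omega>)"
      using \<xi>(1) \<omega>(1) by (auto intro!: path_continuous_image continuous_on_subset[OF continuous_on_family])
    have images: "path_image (family \<circ> \<xi>) \<subseteq> U" "path_image (family \<circ> \<omega>) \<subseteq> U"
      using \<xi>(2) \<omega>(2) marked_locusD(1)[of _ U] unfolding path_image_compose by blast+
    have ends: "pathstart (family \<circ> \<xi>) = p" "pathfinish (family \<circ> \<xi>) = family b"
      "pathstart (family \<circ> \<omega>) = family b" "pathfinish (family \<circ> \<omega>) = family b"
      using \<xi>(3,4) \<omega>(3,4) a(1) by (simp_all add: pathstart_compose pathfinish_compose family_swap_marks)
    show ?thesis
      using paths images ends by (simp add: \<gamma>_def path_image_join)
  qed
  moreover have "Transposition.transpose y y' permutes fibre Z fst p"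
    using y y' by (rule permutes_swap_id)
  ultimately show ?thesis
    unfolding monodromy_group_iff by blast
qed

theorem theorem1p1:
  shows "(\<exists>U. zariski_open U \<and> U \<noteq> {} \<and> unbranched_over 24 Z fst U) \<and>
    (\<forall>U p. zariski_open U \<and> unbranched_over 24 Z fst U \<and> p \<in> U \<longrightarrow>
       monodromy_group Z fst U p = {\<sigma>. \<sigma> permutes fibre Z fst p})"
proof (intro conjI allI impI)
  show "\<exists>U. zariski_open U \<and> U \<noteq> {} \<and> unbranched_over 24 Z fst U"
    using zariski_open_simple_locus simple_locus_nonempty unbranched_over_simple_locus by blast
next
  fix U p assume U: "zariski_open U \<and> unbranched_over 24 Z fst U \<and> p \<in> U"
  then have "finite (fibre Z fst p)"
    by (simp add: unbranched_over_def)
  then show "monodromy_group Z fst U p = {\<sigma>. \<sigma> permutes fibre Z fst p}"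
    using U by (intro monodromy_group_full_if_transpositions transposition_in_monodromy_group) auto
qed

end
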